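(* Let $K$ be a field and, in $S=K[x_1,\ldots,x_{10}]$, let $$L_1=(x_1^2,x_1x_2,x_1x_3,\ldots,x_1x_{10},x_2^2),\qquad L_2=(x_1^2,x_1x_2,x_1x_3,\ldots,x_1x_{10},x_2^2,x_2x_3),$$ which are lex ideals generated by monomials of degree $2$ with $L_1\subset L_2$. Then $\mathrm{hdepth}(L_1)=5$ and $\mathrm{hdepth}(L_2)=6$; in particular $\mathrm{hdepth}(L_1)<\mathrm{hdepth}(L_2)$. Moreover, in $S'=K[x_1,\ldots,x_{11}]$ let $$L_1^\sigma=(x_1x_2,x_1x_3,\ldots,x_1x_{11},x_2x_3),\qquad L_2^\sigma=(x_1x_2,x_1x_3,\ldots,x_1x_{11},x_2x_3,x_2x_4),$$ which are squarefree lex ideals generated by monomials of degree $2$ with $L_1^\sigma\subset L_2^\sigma$. Then $\mathrm{hdepth}(L_1^\sigma)=6$ and $\mathrm{hdepth}(L_2^\sigma)=7$; in particular $\mathrm{hdepth}(L_1^\sigma)<\mathrm{hdepth}(L_2^\sigma)$.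
   Context: Polynomial rings $K[x_1,\ldots,x_n]$ are $\mathbb{Z}$-graded with $\deg(x_i)=1$. A Hilbert decomposition of a graded ideal $I$ is an isomorphism of graded $K$-vector spaces $\mathcal{H}: I\cong\bigoplus_{i=1}^m K[Z_i](-s_i)$ with $s_i\in\mathbb{Z}_{\geq 0}$ and $Z_i\subset\{x_1,\ldots,x_n\}$. Its Hilbert depth is $\mathrm{hdepth}(\mathcal{H})=\min_i|Z_i|$, and $\mathrm{hdepth}(I)$ is the maximum of $\mathrm{hdepth}(\mathcal{H})$ over all Hilbert decompositions $\mathcal{H}$ of $I$. A (squarefree) lex ideal is a (squarefree) monomial ideal $I$ such that whenever $u\in I$ and $v$ are (squarefree) monomials of the same degree with $v>_{\mathrm{lex}}u$ (with $x_1>x_2>\cdots$), then $v\in I$. *)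

theory Defs
  imports "HOL-Library.Poly_Mapping" "HOL-Algebra.Ideal"
begin

text \<open>A monomial is its exponent vector; the variable \<open>x\<^sub>i\<close> has index \<open>i\<close>, starting from 1.\<close>

type_synonym 'k mpoly = "(nat \<Rightarrow>\<^sub>0 nat) \<Rightarrow>\<^sub>0 'k"

definition mon :: "(nat \<Rightarrow>\<^sub>0 nat) \<Rightarrow> 'k::field mpoly" where
  "mon m = Poly_Mapping.single m 1"

definition X :: "nat \<Rightarrow> 'k::field mpoly" where
  "X i = mon (Poly_Mapping.single i 1)"

definition mdeg :: "(nat \<Rightarrow>\<^sub>0 nat) \<Rightarrow> nat" where
  "mdeg m = (\<Sum>i\<in>Poly_Mapping.keys m. Poly_Mapping.lookup m i)"

definition monomials :: "nat set \<Rightarrow> (nat \<Rightarrow>\<^sub>0 nat) set" where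
  "monomials Z = {m. Poly_Mapping.keys m \<subseteq> Z}"

definition polys :: "nat set \<Rightarrow> 'k::field mpoly set" where
  "polys Z = {p. Poly_Mapping.keys p \<subseteq> monomials Z}"

definition homogeneous :: "nat \<Rightarrow> 'k::field mpoly \<Rightarrow> bool" where
  "homogeneous d p \<longleftrightarrow> (\<forall>m\<in>Poly_Mapping.keys p. mdeg m = d)"

definition smul :: "'k::field \<Rightarrow> 'k mpoly \<Rightarrow> 'k mpoly" where
  "smul c p = Poly_Mapping.single 0 c * p"

text \<open>The ring \<open>K[x\<^sub>1,\<dots>,x\<^sub>n]\<close>.\<close>

definition poly_ring :: "nat \<Rightarrow> 'k::field mpoly ring" where
  "poly_ring n =
    \<lparr>carrier = polys {1..n}, mult = (*), one = 1, zero = 0, add = (+)\<rparr>"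


section \<open>Lex ideals\<close>

definition monomial_ideal_on ::
    "nat \<Rightarrow> (nat \<Rightarrow>\<^sub>0 nat) set \<Rightarrow> 'k::field mpoly set \<Rightarrow> bool" where
  "monomial_ideal_on n A I \<longleftrightarrow>
    (\<exists>M \<subseteq> monomials {1..n} \<inter> A. I = Idl\<^bsub>poly_ring n\<^esub> (mon ` M))"

definition squarefree_monomials :: "(nat \<Rightarrow>\<^sub>0 nat) set" where
  "squarefree_monomials = {m. \<forall>i. Poly_Mapping.lookup m i \<le> 1}"

text \<open>The library order on finitely supported functions compares values at the least index
  where they differ, so \<open>u < v\<close> is the lexicographic order with \<open>x\<^sub>1 > x\<^sub>2 > \<dots>\<close>.\<close>

definition lex_ideal :: "nat \<Rightarrow> 'k::field mpoly set \<Rightarrow> bool" where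
  "lex_ideal n I \<longleftrightarrow> monomial_ideal_on n UNIV I \<and>
    (\<forall>u \<in> monomials {1..n}. \<forall>v \<in> monomials {1..n}.
      mon u \<in> I \<and> mdeg v = mdeg u \<and> u < v \<longrightarrow> mon v \<in> I)"

definition squarefree_lex_ideal :: "nat \<Rightarrow> 'k::field mpoly set \<Rightarrow> bool" where
  "squarefree_lex_ideal n I \<longleftrightarrow> monomial_ideal_on n squarefree_monomials I \<and>
    (\<forall>u \<in> monomials {1..n} \<inter> squarefree_monomials.
     \<forall>v \<in> monomials {1..n} \<inter> squarefree_monomials.
      mon u \<in> I \<and> mdeg v = mdeg u \<and> u < v \<longrightarrow> mon v \<in> I)"


section \<open>Hilbert decompositions\<close>

text \<open>The list \<open>D = [(Z\<^sub>1,s\<^sub>1),\<dots>,(Z\<^sub>m,s\<^sub>m)]\<close> stands for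
  \<open>\<Oplus>\<^sub>i K[Z\<^sub>i](-s\<^sub>i)\<close>, whose elements are the families with \<open>i\<close>-th entry in \<open>K[Z\<^sub>i]\<close>,
  extended by 0 to all indices.\<close>

definition dsum :: "(nat set \<times> nat) list \<Rightarrow> (nat \<Rightarrow> 'k::field mpoly) set" where
  "dsum D = {f. (\<forall>i < length D. f i \<in> polys (fst (D ! i))) \<and> (\<forall>i \<ge> length D. f i = 0)}"

text \<open>The degree \<open>d\<close> part of \<open>K[Z](-s)\<close> is the degree \<open>d - s\<close> part of \<open>K[Z]\<close>, which is zero
  if \<open>d < s\<close>.\<close>

definition dsum_part ::
    "(nat set \<times> nat) list \<Rightarrow> nat \<Rightarrow> (nat \<Rightarrow> 'k::field mpoly) set" where
  "dsum_part D d = {f \<in> dsum D. \<forall>i < length D.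
     if snd (D ! i) \<le> d then homogeneous (d - snd (D ! i)) (f i) else f i = 0}"

definition graded_iso ::
    "'k::field mpoly set \<Rightarrow> (nat set \<times> nat) list \<Rightarrow> ('k mpoly \<Rightarrow> nat \<Rightarrow> 'k mpoly) \<Rightarrow> bool" where
  "graded_iso I D \<phi> \<longleftrightarrow>
     bij_betw \<phi> I (dsum D) \<and>
     (\<forall>p\<in>I. \<forall>q\<in>I. \<forall>i. \<phi> (p + q) i = \<phi> p i + \<phi> q i) \<and>
     (\<forall>c. \<forall>p\<in>I. \<forall>i. \<phi> (smul c p) i = smul c (\<phi> p i)) \<and>
     (\<forall>d. \<phi> ` {p\<in>I. homogeneous d p} = dsum_part D d)"

definition graded_ideal :: "nat \<Rightarrow> 'k::field mpoly set \<Rightarrow> bool" where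
  "graded_ideal n I \<longleftrightarrow> ideal I (poly_ring n) \<and>
    (\<exists>G \<subseteq> polys {1..n}. (\<forall>g\<in>G. \<exists>d. homogeneous d g) \<and> I = Idl\<^bsub>poly_ring n\<^esub> G)"

definition hilbert_decomposition ::
    "nat \<Rightarrow> 'k::field mpoly set \<Rightarrow> (nat set \<times> nat) list \<Rightarrow> bool" where
  "hilbert_decomposition n I D \<longleftrightarrow>
     graded_ideal n I \<and> (\<forall>(Z, s) \<in> set D. Z \<subseteq> {1..n}) \<and> (\<exists>\<phi>. graded_iso I D \<phi>)"

definition hdepth_decomposition :: "(nat set \<times> nat) list \<Rightarrow> nat" where
  "hdepth_decomposition D = Min ((\<lambda>(Z, s). card Z) ` set D)"

text \<open>Meaningful for nonzero \<open>I\<close>: then every decomposition has a summand, so that the minimum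
  above is taken over a nonempty set and the maximum below over values at most \<open>n\<close>.\<close>

definition hdepth :: "nat \<Rightarrow> 'k::field mpoly set \<Rightarrow> nat" where
  "hdepth n I = Max (hdepth_decomposition ` {D. hilbert_decomposition n I D})"

end

theory Submission
  imports Defs "HOL-Library.Function_Algebras" "HOL-Computational_Algebra.Formal_Power_Series"
begin

text \<open>Since the homogeneous parts are finite-dimensional, \<open>\<Oplus>\<^sub>i K[Z\<^sub>i](-s\<^sub>i)\<close> decomposes a monomial ideal
  exactly if its Hilbert series \<open>\<Sum>\<^sub>i t^s\<^sub>i / (1 - t)^|Z\<^sub>i|\<close> is that of the ideal. If all
  \<open>|Z\<^sub>i| \<ge> r\<close> and the ideal starts in degree 2, then every summand with a generator in degree 2
  contributes at least \<open>r\<close> in degree 3, so \<open>r H(2) \<le> H(3)\<close>; this gives the upper bounds.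
  The lower bounds are explicit decompositions, checked by an identity of rational functions.\<close>

section \<open>Monomials\<close>

text \<open>What decides the bound is the ratio H(3)/H(2). For \<open>L1\<close> it is 64/11, just
  below 6. The extra generator x_2 x_3 of \<open>L2\<close> adds 1 in degree 2 and 8 in degree 3,
  which gives 72/12 = 6 exactly; this is how the larger ideal gains depth. A decomposition of
  \<open>L2\<close> of depth 6 then has no slack: twelve summands start in degree 2, each with
  exactly six variables, and none starts in degree 3. Passing to the squarefree ideals multiplies
  the series by 1/(1 - t), so H(3) grows by H(2) and the ratio grows by exactly 1. A Hilbert
  decomposition respects the grading and the vector space structure, but not multiplication by
  variables. The summands need not sit in the ideal as cones u K[Z], so a purely numerical table of
  shifts and numbers of variables proves a lower bound. \<open>hdepth\<close> is a
  \<open>Max\<close> over infinitely many decompositions; the upper bound is also what makes the set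
  of values finite.\<close>

lemma mdeg_eq_sum:
  assumes "finite F" "Poly_Mapping.keys m \<subseteq> F"
  shows "mdeg m = (\<Sum>i\<in>F. Poly_Mapping.lookup m i)"
  unfolding mdeg_def using assms
  by (intro sum.mono_neutral_left) (auto simp: in_keys_iff)

lemma mdeg_add: "mdeg (u + v) = mdeg u + mdeg v"
proof -
  let ?F = "Poly_Mapping.keys u \<union> Poly_Mapping.keys v"
  have "mdeg (u + v) = (\<Sum>i\<in>?F. Poly_Mapping.lookup (u + v) i)"
    by (intro mdeg_eq_sum) (auto simp: Poly_Mapping.keys_add)
  also have "\<dots> = mdeg u + mdeg v"
    by (simp add: lookup_add sum.distrib mdeg_eq_sum[of ?F u] mdeg_eq_sum[of ?F v])
  finally show ?thesis .
qed

lemma mdeg_single [simp]: "mdeg (Poly_Mapping.single i k) = k"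
  by (auto simp: mdeg_def)

lemma mdeg_0 [simp]: "mdeg 0 = 0"
  by (simp add: mdeg_def)

lemma lookup_le_mdeg: "Poly_Mapping.lookup m i \<le> mdeg m"
  by (cases "i \<in> Poly_Mapping.keys m") (auto simp: mdeg_def in_keys_iff intro: member_le_sum)

lemma monomials_iff: "m \<in> monomials Z \<longleftrightarrow> (\<forall>i. i \<notin> Z \<longrightarrow> Poly_Mapping.lookup m i = 0)"
  by (auto simp: monomials_def in_keys_iff)

lemma monomials_mono: "Y \<subseteq> Z \<Longrightarrow> monomials Y \<subseteq> monomials Z"
  by (auto simp: monomials_def)

lemma monomials_empty [simp]: "monomials {} = {0}"
  by (auto simp: monomials_def)

lemma monomials_add: "u \<in> monomials Z \<Longrightarrow> v \<in> monomials Z \<Longrightarrow> u + v \<in> monomials Z"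
  by (simp add: monomials_iff lookup_add)

lemma single_in_monomials: "i \<in> Z \<Longrightarrow> Poly_Mapping.single i k \<in> monomials Z"
  by (auto simp: monomials_iff lookup_single when_def)

lemma zero_in_monomials [simp]: "0 \<in> monomials Z"
  by (simp add: monomials_iff)

lemma lookup_smul: "Poly_Mapping.lookup (smul c p) m = c * Poly_Mapping.lookup p m"
  unfolding smul_def mult_map_scale_conv_mult[symmetric]
  by transfer (simp add: when_def)

lemma mon_add: "mon (u + v) = mon u * mon v"
  by (simp add: mon_def mult_single)

lemma keys_mon [simp]: "Poly_Mapping.keys (mon m) = {m}"
  by (simp add: mon_def)

lemma lookup_mon: "Poly_Mapping.lookup (mon m) m' = (if m = m' then 1 else 0)"
  by (simp add: mon_def lookup_single when_def)

section \<open>Ideals generated by monomials\<close>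

text \<open>A monomial ideal is the K-span of its monomials. All linear algebra below uses only this
  description by an exponent set; \<open>Idl_mon_eq\<close> connects it with the generated
  ideals.\<close>

definition supported_on :: "(nat \<Rightarrow>\<^sub>0 nat) set \<Rightarrow> 'k::field mpoly set" where
  "supported_on A = {p. Poly_Mapping.keys p \<subseteq> A}"

lemma supported_on_iff: "p \<in> supported_on A \<longleftrightarrow> (\<forall>m. m \<notin> A \<longrightarrow> Poly_Mapping.lookup p m = 0)"
  by (auto simp: supported_on_def in_keys_iff)

lemma mon_in_supported_on_iff [simp]: "mon m \<in> supported_on A \<longleftrightarrow> m \<in> A"
  by (simp add: supported_on_def)

definition divides :: "(nat \<Rightarrow>\<^sub>0 nat) \<Rightarrow> (nat \<Rightarrow>\<^sub>0 nat) \<Rightarrow> bool" where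
  "divides g m \<longleftrightarrow> (\<forall>i. Poly_Mapping.lookup g i \<le> Poly_Mapping.lookup m i)"

definition upset :: "nat \<Rightarrow> (nat \<Rightarrow>\<^sub>0 nat) set \<Rightarrow> (nat \<Rightarrow>\<^sub>0 nat) set" where
  "upset n M = {m \<in> monomials {1..n}. \<exists>g\<in>M. divides g m}"

lemma upset_subset_monomials: "upset n M \<subseteq> monomials {1..n}"
  by (auto simp: upset_def)

lemma polys_mult:
  assumes "p \<in> polys Z" "q \<in> polys Z"
  shows "p * q \<in> polys Z"
  using assms keys_mult[of p q] by (fastforce simp: polys_def intro: monomials_add)

lemma polys_add: "p \<in> polys Z \<Longrightarrow> q \<in> polys Z \<Longrightarrow> p + q \<in> polys Z"
  using Poly_Mapping.keys_add[of p q] by (auto simp: polys_def)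

lemma mpoly_minus_in_polys: "p \<in> polys Z \<Longrightarrow> - p \<in> polys Z"
  by (auto simp: polys_def in_keys_iff)

lemma ring_poly_ring: "ring (poly_ring n :: 'k::field mpoly ring)"
proof (rule ringI)
  show "abelian_group (poly_ring n :: 'k mpoly ring)"
  proof (rule abelian_groupI)
    fix p :: "'k mpoly" assume "p \<in> carrier (poly_ring n)"
    then show "\<exists>q\<in>carrier (poly_ring n). q \<oplus>\<^bsub>poly_ring n\<^esub> p = \<zero>\<^bsub>poly_ring n\<^esub>"
      by (intro bexI[of _ "- p"]) (auto simp: poly_ring_def mpoly_minus_in_polys)
  qed (auto simp: poly_ring_def polys_add algebra_simps, auto simp: polys_def)
  show "Group.monoid (poly_ring n :: 'k mpoly ring)"
    by (rule Group.monoidI) (auto simp: poly_ring_def polys_mult algebra_simps, auto simp: polys_def)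
qed (auto simp: poly_ring_def algebra_simps)

lemma supported_on_upset_ideal:
  "ideal (supported_on (upset n M) :: 'k::field mpoly set) (poly_ring n)"
proof (rule idealI)
  show "ring (poly_ring n :: 'k mpoly ring)" by (rule ring_poly_ring)
  then interpret ring "poly_ring n :: 'k mpoly ring" .
  let ?I = "supported_on (upset n M) :: 'k mpoly set"
  have sub: "?I \<subseteq> polys {1..n}"
    using upset_subset_monomials by (fastforce simp: supported_on_def polys_def)
  show "subgroup ?I (add_monoid (poly_ring n))"
  proof (rule add.subgroupI)
    show "?I \<noteq> {}"
      by (auto simp: supported_on_def intro!: exI[of _ 0])
    fix a assume a: "a \<in> ?I"
    have "\<ominus>\<^bsub>poly_ring n\<^esub> a = - a"
      using a sub mpoly_minus_in_polys
      by (intro minus_equality) (auto simp: poly_ring_def)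
    with a show "\<ominus>\<^bsub>poly_ring n\<^esub> a \<in> ?I"
      by (simp add: supported_on_iff)
  qed (use sub in \<open>auto simp: poly_ring_def supported_on_iff lookup_add\<close>)
  have mult: "x * a \<in> ?I" if a: "a \<in> ?I" and x: "x \<in> polys {1..n}" for a x
    unfolding supported_on_def
  proof safe
    fix m assume "m \<in> Poly_Mapping.keys (x * a)"
    then obtain u v where uv: "m = u + v" "u \<in> Poly_Mapping.keys x" "v \<in> Poly_Mapping.keys a"
      using keys_mult[of x a] by auto
    then have "u \<in> monomials {1..n}" "v \<in> upset n M"
      using a x by (auto simp: supported_on_def polys_def)
    then show "m \<in> upset n M"
      using uv(1) by (auto simp: upset_def divides_def lookup_add intro: monomials_add trans_le_add2)
  qed
  show "x \<otimes>\<^bsub>poly_ring n\<^esub> a \<in> ?I" "a \<otimes>\<^bsub>poly_ring n\<^esub> x \<in> ?I"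
    if "a \<in> ?I" "x \<in> carrier (poly_ring n)" for a x
    using mult that by (auto simp: poly_ring_def mult.commute)
qed

text \<open>One inclusion is minimality of the generated ideal. For the other, a term whose monomial
  is a multiple of some g in \<open>M\<close> is a multiple of the generator \<open>mon g\<close>,
  and a polynomial is the finite sum of its terms.\<close>

lemma Idl_mon_eq:
  assumes M: "M \<subseteq> monomials {1..n}"
  shows "Idl\<^bsub>poly_ring n\<^esub> (mon ` M) = (supported_on (upset n M) :: 'k::field mpoly set)"
proof
  interpret ring "poly_ring n :: 'k mpoly ring" by (rule ring_poly_ring)
  have car: "mon ` M \<subseteq> carrier (poly_ring n :: 'k mpoly ring)"
    using M by (auto simp: poly_ring_def polys_def)
  show "Idl\<^bsub>poly_ring n\<^esub> (mon ` M) \<subseteq> (supported_on (upset n M) :: 'k mpoly set)"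
    using M by (intro genideal_minimal supported_on_upset_ideal) (auto simp: upset_def divides_def)
  interpret I: ideal "Idl\<^bsub>poly_ring n\<^esub> (mon ` M) :: 'k mpoly set" "poly_ring n"
    by (rule genideal_ideal[OF car])
  show "supported_on (upset n M) \<subseteq> (Idl\<^bsub>poly_ring n\<^esub> (mon ` M) :: 'k mpoly set)"
  proof
    fix p :: "'k mpoly" assume p: "p \<in> supported_on (upset n M)"
    have term_in: "Poly_Mapping.single m c \<in> Idl\<^bsub>poly_ring n\<^esub> (mon ` M)"
      if "m \<in> upset n M" for m and c :: 'k
    proof -
      from that obtain g where g: "g \<in> M" "\<And>i. Poly_Mapping.lookup g i \<le> Poly_Mapping.lookup m i"
        and m: "m \<in> monomials {1..n}" by (auto simp: upset_def divides_def)
      have "m - g \<in> monomials {1..n}"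
        using m by (simp add: monomials_iff minus_poly_mapping.rep_eq)
      then have "Poly_Mapping.single (m - g) c \<in> carrier (poly_ring n)"
        by (simp add: poly_ring_def polys_def)
      then have "Poly_Mapping.single (m - g) c \<otimes>\<^bsub>poly_ring n\<^esub> mon g \<in> Idl\<^bsub>poly_ring n\<^esub> (mon ` M)"
        using g genideal_self[OF car] by (intro I.I_l_closed) auto
      \<comment> \<open>Subtraction of exponents is truncated; divisibility of m by g makes it
        exact.\<close>
      moreover have "(m - g) + g = m"
        using g by (intro poly_mapping_eqI) (simp add: lookup_add minus_poly_mapping.rep_eq)
      ultimately show ?thesis
        by (simp add: poly_ring_def mon_def mult_single)
    qed
    have zero: "0 \<in> Idl\<^bsub>poly_ring n\<^esub> (mon ` M :: 'k mpoly set)"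
      using I.zero_closed by (simp add: poly_ring_def)
    have add: "a + b \<in> Idl\<^bsub>poly_ring n\<^esub> (mon ` M)"
      if "a \<in> Idl\<^bsub>poly_ring n\<^esub> (mon ` M)" "b \<in> Idl\<^bsub>poly_ring n\<^esub> (mon ` M)" for a b :: "'k mpoly"
      using I.a_closed[OF that] by (simp add: poly_ring_def)
    have "(\<Sum>m\<in>F. Poly_Mapping.single m (Poly_Mapping.lookup p m)) \<in> Idl\<^bsub>poly_ring n\<^esub> (mon ` M)"
      if "finite F" "F \<subseteq> upset n M" for F
      using that by (induction F) (auto intro!: zero add term_in)
    from this[of "Poly_Mapping.keys p"] p
    have "(\<Sum>m\<in>Poly_Mapping.keys p. Poly_Mapping.single m (Poly_Mapping.lookup p m))
        \<in> Idl\<^bsub>poly_ring n\<^esub> (mon ` M)"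
      by (auto simp: supported_on_def)
    moreover have "(\<Sum>m\<in>Poly_Mapping.keys p. Poly_Mapping.single m (Poly_Mapping.lookup p m)) = p"
      by (intro poly_mapping_eqI)
        (auto simp: lookup_sum lookup_single when_def in_keys_iff)
    ultimately show "p \<in> Idl\<^bsub>poly_ring n\<^esub> (mon ` M)" by simp
  qed
qed

section \<open>Hilbert series\<close>

text \<open>Integer coefficients allow differences of series. \<open>card\<close> is the dimension
  only where the degree parts are finite, so the lemmas on unions and decompositions assume finitely
  many variables.\<close>

definition hilbert_series :: "(nat \<Rightarrow>\<^sub>0 nat) set \<Rightarrow> int fps" where
  "hilbert_series A = Abs_fps (\<lambda>d. int (card {m \<in> A. mdeg m = d}))"

definition geometric :: "int fps" where
  "geometric = Abs_fps (\<lambda>_. 1)"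

lemma geometric_mult: "(1 - fps_X) * geometric = 1"
  by (intro fps_ext) (auto simp: geometric_def left_diff_distrib fps_X_mult_nth)

lemma finite_monomials_mdeg:
  assumes "finite Z"
  shows "finite {m \<in> monomials Z. mdeg m = d}"
proof -
  have "{m \<in> monomials Z. mdeg m = d} \<subseteq>
      (\<lambda>f. Abs_poly_mapping f) ` {f. \<forall>i. (i \<in> Z \<longrightarrow> f i \<in> {..d}) \<and> (i \<notin> Z \<longrightarrow> f i = 0)}"
  proof
    fix m assume "m \<in> {m \<in> monomials Z. mdeg m = d}"
    then show "m \<in> (\<lambda>f. Abs_poly_mapping f) ` {f. \<forall>i. (i \<in> Z \<longrightarrow> f i \<in> {..d}) \<and> (i \<notin> Z \<longrightarrow> f i = 0)}"
      using lookup_le_mdeg[of m]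
      by (intro image_eqI[of _ _ "Poly_Mapping.lookup m"]) (auto simp: monomials_iff)
  qed
  moreover have "finite {f :: nat \<Rightarrow> nat. \<forall>i. (i \<in> Z \<longrightarrow> f i \<in> {..d}) \<and> (i \<notin> Z \<longrightarrow> f i = 0)}"
    using assms by (intro finite_set_of_finite_funs) auto
  ultimately show ?thesis by (meson finite_imageI finite_subset)
qed

lemma hilbert_series_Un:
  assumes "finite Z" "A \<subseteq> monomials Z" "B \<subseteq> monomials Z" "A \<inter> B = {}"
  shows "hilbert_series (A \<union> B) = hilbert_series A + hilbert_series B"
proof (rule fps_ext)
  fix d
  have fin: "finite {m \<in> C. mdeg m = d}" if "C \<subseteq> monomials Z" for C
    by (rule finite_subset[OF _ finite_monomials_mdeg[OF assms(1), of d]]) (use that in auto)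
  have "{m \<in> A \<union> B. mdeg m = d} = {m \<in> A. mdeg m = d} \<union> {m \<in> B. mdeg m = d}" by auto
  moreover have "card ({m \<in> A. mdeg m = d} \<union> {m \<in> B. mdeg m = d})
      = card {m \<in> A. mdeg m = d} + card {m \<in> B. mdeg m = d}"
    using assms fin by (intro card_Un_disjoint) auto
  ultimately show "fps_nth (hilbert_series (A \<union> B)) d = fps_nth (hilbert_series A + hilbert_series B) d"
    by (simp add: hilbert_series_def)
qed

lemma hilbert_series_shift:
  "hilbert_series ((+) u ` A) = fps_X ^ mdeg u * hilbert_series A"
proof (rule fps_ext)
  fix d
  have "{m \<in> (+) u ` A. mdeg m = d} = (if d < mdeg u then {} else (+) u ` {m \<in> A. mdeg m = d - mdeg u})"
    by (auto simp: mdeg_add)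
  then show "fps_nth (hilbert_series ((+) u ` A)) d = fps_nth (fps_X ^ mdeg u * hilbert_series A) d"
    by (simp add: hilbert_series_def fps_X_power_mult_nth card_image)
qed

lemma monomials_insert:
  assumes "z \<notin> Z"
  shows "monomials (insert z Z) =
    monomials Z \<union> (+) (Poly_Mapping.single z 1) ` monomials (insert z Z)"
    and "monomials Z \<inter> (+) (Poly_Mapping.single z 1) ` monomials (insert z Z) = {}"
proof -
  have "m \<in> (+) (Poly_Mapping.single z 1) ` monomials (insert z Z)"
    if "m \<in> monomials (insert z Z)" "m \<notin> monomials Z" for m
  proof (rule image_eqI)
    have "Poly_Mapping.lookup m z \<noteq> 0" using that unfolding monomials_iff by (metis insertE)
    then show "m = Poly_Mapping.single z 1 + (m - Poly_Mapping.single z 1)"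
      by (intro poly_mapping_eqI)
        (auto simp: lookup_add minus_poly_mapping.rep_eq lookup_single when_def)
    show "m - Poly_Mapping.single z 1 \<in> monomials (insert z Z)"
      using that by (auto simp: monomials_iff minus_poly_mapping.rep_eq)
  qed
  then show "monomials (insert z Z) =
      monomials Z \<union> (+) (Poly_Mapping.single z 1) ` monomials (insert z Z)"
    using monomials_mono[of Z "insert z Z"]
    by (auto simp: intro!: monomials_add single_in_monomials)
  show "monomials Z \<inter> (+) (Poly_Mapping.single z 1) ` monomials (insert z Z) = {}"
    using assms by (auto simp: monomials_iff lookup_add dest!: spec[of _ z])
qed

text \<open>Sorting monomials by divisibility by the new variable gives H = H' + t H, where H' is
  the series for the old variables. Hence (1 - t) H = H', and multiplication by
  \<open>geometric\<close> solves for H.\<close>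

lemma hilbert_series_monomials:
  assumes "finite Z"
  shows "hilbert_series (monomials Z) = geometric ^ card Z"
  using assms
proof (induction Z)
  case empty
  have "{m \<in> monomials {}. mdeg m = d} = (if d = 0 then {0} else {})" for d
    by auto
  then show ?case
    by (intro fps_ext) (simp add: hilbert_series_def)
next
  case (insert z Z)
  let ?H = "hilbert_series (monomials (insert z Z))"
  let ?T = "(+) (Poly_Mapping.single z 1) ` monomials (insert z Z)"
  have "?H = hilbert_series (monomials Z \<union> ?T)"
    by (rule arg_cong[OF monomials_insert(1)[OF insert.hyps(2)]])
  also have "\<dots> = hilbert_series (monomials Z) + hilbert_series ?T"
  proof (rule hilbert_series_Un)
    show "?T \<subseteq> monomials (insert z Z)"
      by (auto intro: monomials_add single_in_monomials)
  qed (use insert.hyps monomials_insert(2)[OF insert.hyps(2)] in \<open>auto intro!: monomials_mono\<close>)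
  also have "hilbert_series ?T = fps_X * ?H"
    by (simp add: hilbert_series_shift)
  finally have "?H = hilbert_series (monomials Z) + fps_X * ?H" .
  then have "(1 - fps_X) * ?H = geometric ^ card Z"
    by (metis add_diff_cancel_right' insert.IH left_diff_distrib mult_1)
  then have "(geometric * (1 - fps_X)) * ?H = geometric ^ Suc (card Z)"
    by (simp add: mult.assoc)
  then show ?case
    using insert.hyps by (simp add: geometric_mult mult.commute[of geometric])
qed

section \<open>Graded isomorphisms and Hilbert series\<close>

text \<open>Common frame for polynomials, with coordinates indexed by monomials, and for families of
  polynomials, indexed by pairs of position and monomial. The units need not span the whole space,
  since a family may have infinitely many nonzero entries; \<open>span_units\<close> therefore
  speaks of finite sets of coordinates.\<close>

locale coordinate_space = vector_space scale
  for scale :: "'a::field \<Rightarrow> 'b::ab_group_add \<Rightarrow> 'b" +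
  fixes coord :: "'b \<Rightarrow> 'i \<Rightarrow> 'a" and unit :: "'i \<Rightarrow> 'b"
  assumes coord_add: "coord (x + y) t = coord x t + coord y t"
    and coord_scale: "coord (scale a x) t = a * coord x t"
    and coord_unit: "coord (unit t) t' = (if t = t' then 1 else 0)"
    and coord_eqI: "(\<And>t. coord x t = coord y t) \<Longrightarrow> x = y"
begin

lemma coord_zero: "coord 0 t = 0"
  using coord_scale[of 0 0 t] by simp

lemma coord_sum: "coord (\<Sum>j\<in>F. f j) t = (\<Sum>j\<in>F. coord (f j) t)"
  by (induction F rule: infinite_finite_induct) (auto simp: coord_zero coord_add)

lemma inj_unit: "inj_on unit T"
  by (rule inj_onI) (metis coord_unit zero_neq_one)

lemma independent_units: "independent (unit ` T)"
  unfolding dependent_explicit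
proof safe
  fix F u v assume F: "finite F" "F \<subseteq> unit ` T" "(\<Sum>v\<in>F. scale (u v) v) = 0"
    and v: "v \<in> F" "u v \<noteq> 0"
  from F v obtain t where t: "v = unit t" by auto
  have "0 = (\<Sum>w\<in>F. coord (scale (u w) w) t)"
    using F(3) coord_zero by (simp flip: coord_sum)
  also have "\<dots> = (\<Sum>w\<in>F. if w = v then u v else 0)"
  proof (intro sum.cong refl)
    fix w assume "w \<in> F"
    with F(2) obtain t' where "w = unit t'" by auto
    then show "coord (scale (u w) w) t = (if w = v then u v else 0)"
      using t inj_unit[of UNIV] by (auto simp: coord_scale coord_unit inj_eq)
  qed
  finally show False using F v by simp
qed

lemma span_units:
  assumes "finite T"
  shows "span (unit ` T) = {x. \<forall>t. t \<notin> T \<longrightarrow> coord x t = 0}"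
proof
  have "subspace {x. \<forall>t. t \<notin> T \<longrightarrow> coord x t = 0}"
    by (auto simp: subspace_def coord_zero coord_add coord_scale)
  then show "span (unit ` T) \<subseteq> {x. \<forall>t. t \<notin> T \<longrightarrow> coord x t = 0}"
    by (intro span_minimal) (auto simp: coord_unit)
  show "{x. \<forall>t. t \<notin> T \<longrightarrow> coord x t = 0} \<subseteq> span (unit ` T)"
  proof safe
    fix x assume x: "\<forall>t. t \<notin> T \<longrightarrow> coord x t = 0"
    have "x = (\<Sum>s\<in>T. scale (coord x s) (unit s))"
      using x assms
      by (intro coord_eqI) (auto simp: coord_sum coord_scale coord_unit if_distrib cong: if_cong)
    also have "\<dots> \<in> span (unit ` T)"
      by (intro span_sum span_scale span_base) auto
    finally show "x \<in> span (unit ` T)" .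
  qed
qed

end

text \<open>A graded isomorphism is linear only on the ideal and arbitrary elsewhere. It is replaced
  by the globally linear map \<open>\<psi>\<close> that agrees with it on the basis
  \<open>B\<close>, and hence on the span; then invariance of dimension applies.\<close>

lemma (in vector_space_pair) card_bases_eq:
  assumes B: "vs1.independent B" and C: "vs2.independent C"
    and \<phi>: "bij_betw \<phi> (vs1.span B) (vs2.span C)"
    and add: "\<And>x y. x \<in> vs1.span B \<Longrightarrow> y \<in> vs1.span B \<Longrightarrow> \<phi> (x + y) = \<phi> x + \<phi> y"
    and scale: "\<And>c x. x \<in> vs1.span B \<Longrightarrow> \<phi> (s1 c x) = s2 c (\<phi> x)"
  shows "card B = card C"
proof -
  define \<psi> where "\<psi> = construct B \<phi>"
  have lin: "Vector_Spaces.linear s1 s2 \<psi>" unfolding \<psi>_def by (rule linear_construct[OF B])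
  \<comment> \<open>Membership is carried through the induction because \<open>\<phi>\<close> is
    known to be additive only on the span.\<close>
  have "x \<in> vs1.span B \<and> \<psi> x = \<phi> x" if "x \<in> vs1.span B" for x
    using that
  proof (induction x rule: vs1.span_induct_alt)
    case base
    have "\<phi> 0 = 0" using scale[of 0 0] vs1.span_zero by simp
    then show ?case using linear_0[OF lin] vs1.span_zero by simp
  next
    case (step c x y)
    then have "x \<in> vs1.span B" by (auto intro: vs1.span_base)
    moreover have "\<psi> x = \<phi> x" unfolding \<psi>_def using step by (intro construct_basis[OF B])
    ultimately show ?case
      using step
      by (simp add: linear_add[OF lin] linear_scale[OF lin] add scale vs1.span_scale vs1.span_add)
  qed
  then have eq: "\<psi> x = \<phi> x" if "x \<in> vs1.span B" for x using that by blast
  have inj: "inj_on \<psi> (vs1.span B)"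
    using \<phi> eq by (auto simp: bij_betw_def inj_on_def)
  then have ind: "vs2.independent (\<psi> ` B)"
    by (rule linear_independent_injective_image[OF lin B])
  have "vs2.span (\<psi> ` B) = \<psi> ` vs1.span B"
    by (rule linear_span_image[OF lin])
  also have "\<dots> = vs2.span C"
    using \<phi> eq by (auto simp: bij_betw_def image_iff) 
  finally have "card (\<psi> ` B) = card C"
    using vs2.dim_eq_card[OF _ ind] vs2.dim_eq_card[OF _ C] by metis
  then show ?thesis
    using inj vs1.span_superset by (metis card_image inj_on_subset)
qed

section \<open>Monomial bases of polynomials and of direct sums\<close>

interpretation mpoly: coordinate_space "smul :: 'k::field \<Rightarrow> _" Poly_Mapping.lookup mon
proof unfold_locales
  fix x y :: "'k mpoly" assume "\<And>t. Poly_Mapping.lookup x t = Poly_Mapping.lookup y t"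
  then show "x = y" by (rule poly_mapping_eqI)
qed (auto simp: lookup_smul lookup_add lookup_mon algebra_simps intro!: poly_mapping_eqI)

interpretation families: coordinate_space
  "\<lambda>c f (j::nat). smul c (f j) :: 'k::field mpoly"
  "\<lambda>f t. Poly_Mapping.lookup (f (fst t)) (snd t)"
  "\<lambda>t j. if j = fst t then mon (snd t) else (0 :: 'k mpoly)"
proof unfold_locales
  fix x y :: "nat \<Rightarrow> 'k mpoly"
  assume "\<And>t. Poly_Mapping.lookup (x (fst t)) (snd t) = Poly_Mapping.lookup (y (fst t)) (snd t)"
  from this[of "(_, _)"] show "x = y" by (intro ext poly_mapping_eqI) simp
qed (auto simp: lookup_smul lookup_add lookup_mon algebra_simps intro!: poly_mapping_eqI ext)

interpretation mpoly_families: vector_space_pair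
  "smul :: 'k::field \<Rightarrow> _" "\<lambda>c f (j::nat). smul c (f j) :: 'k mpoly"
  by unfold_locales

text \<open>The monomial basis of the degree d part of the direct sum, as pairs of a summand and a
  monomial in it. Writing the degree condition as a sum leaves no pair for a summand with shift
  above d, in accordance with \<open>dsum_part\<close>.\<close>

definition basis :: "(nat set \<times> nat) list \<Rightarrow> nat \<Rightarrow> (nat \<times> (nat \<Rightarrow>\<^sub>0 nat)) set" where
  "basis D d = (SIGMA i:{..<length D}. {m \<in> monomials (fst (D ! i)). snd (D ! i) + mdeg m = d})"

text \<open>This and the next lemma put membership into the form of \<open>span_units\<close>, as
  vanishing of coordinates. Every pair has some degree, so the union over d just drops the degree
  condition.\<close>

lemma mem_dsum_iff:
  "f \<in> dsum D \<longleftrightarrow>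
    (\<forall>i m. (i, m) \<notin> (\<Union>d. basis D d) \<longrightarrow> Poly_Mapping.lookup (f i) m = 0)"
  (is "?l \<longleftrightarrow> ?r")
proof
  assume l: ?l
  show ?r
  proof (intro allI impI)
    fix i m assume im: "(i, m) \<notin> (\<Union>d. basis D d)"
    show "Poly_Mapping.lookup (f i) m = 0"
    proof (cases "i < length D")
      case True
      with im have "m \<notin> monomials (fst (D ! i))" by (auto simp: basis_def)
      moreover have "Poly_Mapping.keys (f i) \<subseteq> monomials (fst (D ! i))"
        using l True by (auto simp: dsum_def polys_def)
      ultimately show ?thesis by (meson in_keys_iff subsetD)
    qed (use l in \<open>auto simp: dsum_def\<close>)
  qed
next
  assume r: ?r
  have "f i \<in> polys (fst (D ! i))" if "i < length D" for i
    using r that by (auto simp: polys_def basis_def in_keys_iff)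
  moreover have "f i = 0" if "i \<ge> length D" for i
    using r that by (intro poly_mapping_eqI) (auto simp: basis_def)
  ultimately show ?l by (auto simp: dsum_def)
qed

lemma mem_dsum_part_iff:
  "f \<in> dsum_part D d \<longleftrightarrow> (\<forall>i m. (i, m) \<notin> basis D d \<longrightarrow> Poly_Mapping.lookup (f i) m = 0)"
  (is "?l \<longleftrightarrow> ?r")
proof
  assume l: ?l
  show ?r
  proof safe
    fix i m assume im: "(i, m) \<notin> basis D d"
    show "Poly_Mapping.lookup (f i) m = 0"
    proof (cases "i < length D")
      case True
      show ?thesis
      proof (rule ccontr)
        assume m: "Poly_Mapping.lookup (f i) m \<noteq> 0"
        then have "f i \<noteq> 0" "m \<in> Poly_Mapping.keys (f i)" by (auto simp: in_keys_iff)
        moreover from this l True have "m \<in> monomials (fst (D ! i))"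
          by (auto simp: dsum_part_def dsum_def polys_def)
        ultimately have "(i, m) \<in> basis D d"
          using l True by (auto simp: dsum_part_def basis_def homogeneous_def split: if_splits)
        with im show False by contradiction
      qed
    qed (use l in \<open>auto simp: dsum_part_def dsum_def\<close>)
  qed
next
  assume r: ?r
  then have "f \<in> dsum D" unfolding mem_dsum_iff by blast
  moreover have "if snd (D ! i) \<le> d then homogeneous (d - snd (D ! i)) (f i) else f i = 0"
    if "i < length D" for i
    using r that
    by (auto simp: homogeneous_def basis_def in_keys_iff intro!: poly_mapping_eqI)
      (metis add_diff_cancel_left')
  ultimately show ?l by (auto simp: dsum_part_def)
qed

definition decomposition_series :: "(nat set \<times> nat) list \<Rightarrow> int fps" where
  "decomposition_series D = (\<Sum>(Z, s)\<leftarrow>D. fps_X ^ s * geometric ^ card Z)"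

lemma finite_basis_card:
  assumes "\<forall>(Z, s)\<in>set D. finite Z"
  shows "finite (basis D d)"
    and "int (card (basis D d)) = fps_nth (decomposition_series D) d"
proof -
  define M where "M i = {m \<in> monomials (fst (D ! i)). snd (D ! i) + mdeg m = d}" for i
  have finD: "finite (fst (D ! i))" if "i < length D" for i
    using assms that by (auto simp: case_prod_unfold)
  have fin: "finite (M i)" if "i < length D" for i
    by (rule finite_subset[OF _ finite_monomials_mdeg[OF finD[OF that], of "d - snd (D ! i)"]])
      (auto simp: M_def)
  then show "finite (basis D d)"
    unfolding basis_def M_def by (intro finite_SigmaI) auto
  have M: "int (card (M i)) = fps_nth (fps_X ^ snd (D ! i) * geometric ^ card (fst (D ! i))) d"
    if "i < length D" for i
  proof -
    have "M i = (if d < snd (D ! i) then {} else {m \<in> monomials (fst (D ! i)). mdeg m = d - snd (D ! i)})"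
      by (auto simp: M_def)
    then show ?thesis
      using hilbert_series_monomials[OF finD[OF that]]
      by (simp add: fps_X_power_mult_nth hilbert_series_def flip: hilbert_series_monomials[OF finD[OF that]])
  qed
  have "int (card (basis D d)) = (\<Sum>i<length D. int (card (M i)))"
    unfolding basis_def using fin by (simp add: card_SigmaI M_def)
  also have "\<dots> = (\<Sum>i<length D. fps_nth (fps_X ^ snd (D ! i) * geometric ^ card (fst (D ! i))) d)"
    by (intro sum.cong M) auto
  also have "\<dots> = fps_nth (decomposition_series D) d"
    unfolding decomposition_series_def
    by (simp add: sum_list_sum_nth fps_sum_nth case_prod_unfold atLeast0LessThan)
  finally show "int (card (basis D d)) = fps_nth (decomposition_series D) d" .
qed

text \<open>In each degree \<open>\<phi>\<close> restricts to a linear bijection between the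
  homogeneous parts, and both parts are spanned by units over finite sets of coordinates, whose
  sizes are the two coefficients.\<close>

lemma graded_iso_imp_series_eq:
  fixes \<phi> :: "'k::field mpoly \<Rightarrow> nat \<Rightarrow> 'k mpoly"
  assumes A: "A \<subseteq> monomials Y" "finite Y"
    and D: "\<forall>(Z, s)\<in>set D. finite Z"
    and iso: "graded_iso (supported_on A) D \<phi>"
  shows "hilbert_series A = decomposition_series D"
proof (rule fps_ext)
  fix d
  define Ad where "Ad = {m \<in> A. mdeg m = d}"
  let ?e = "\<lambda>t j. if j = fst t then mon (snd t) else (0 :: 'k mpoly)"
  have fin: "finite Ad"
    by (rule finite_subset[OF _ finite_monomials_mdeg[OF A(2), of d]]) (use A(1) in \<open>auto simp: Ad_def\<close>)
  have 1: "mpoly.span (mon ` Ad) = {p \<in> supported_on A. homogeneous d p}"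
    by (subst mpoly.span_units[OF fin])
      (auto simp: supported_on_iff homogeneous_def in_keys_iff Ad_def)
  have 2: "families.span (?e ` basis D d) = dsum_part D d"
    by (subst families.span_units[OF finite_basis_card(1)[of D, OF D]]) (auto simp: mem_dsum_part_iff)
  have "card (mon ` Ad :: 'k mpoly set) = card (?e ` basis D d)"
  proof (rule mpoly_families.card_bases_eq)
    show "bij_betw \<phi> (mpoly.span (mon ` Ad)) (families.span (?e ` basis D d))"
      unfolding 1 2 using iso by (auto simp: graded_iso_def bij_betw_def intro: inj_on_subset)
  qed (use iso in \<open>auto simp: 1 mpoly.independent_units families.independent_units graded_iso_def intro!: ext\<close>)
  then have "card Ad = card (basis D d)"
    by (simp add: card_image mpoly.inj_unit families.inj_unit)
  then show "fps_nth (hilbert_series A) d = fps_nth (decomposition_series D) d"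
    using finite_basis_card(2)[of D d, OF D] by (simp add: hilbert_series_def Ad_def)
qed

text \<open>Equal series give, in each degree, a bijection between the monomials of \<open>A\<close>
  and the basis pairs. Glued together, these reindex coefficients, and reindexing is a linear map
  that preserves degrees.\<close>

lemma series_eq_imp_graded_iso:
  assumes A: "A \<subseteq> monomials Y" "finite Y"
    and D: "\<forall>(Z, s)\<in>set D. finite Z"
    and eq: "hilbert_series A = decomposition_series D"
  shows "\<exists>\<phi>. graded_iso (supported_on A :: 'k::field mpoly set) D \<phi>"
proof -
  have "\<exists>\<beta>. bij_betw \<beta> {m \<in> A. mdeg m = d} (basis D d)" for d
  proof (rule finite_same_card_bij)
    show "finite {m \<in> A. mdeg m = d}"
      by (rule finite_subset[OF _ finite_monomials_mdeg[OF A(2), of d]]) (use A(1) in auto)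
    show "finite (basis D d)" by (rule finite_basis_card(1)[of D, OF D])
    show "card {m \<in> A. mdeg m = d} = card (basis D d)"
      using finite_basis_card(2)[of D d, OF D] arg_cong[OF eq, of "\<lambda>f. fps_nth f d"]
      by (simp add: hilbert_series_def)
  qed
  then obtain \<beta> where \<beta>: "\<And>d. bij_betw (\<beta> d) {m \<in> A. mdeg m = d} (basis D d)" by metis
  define B where "B = (\<Union>d. basis D d)"
  define b where "b m = \<beta> (mdeg m) m" for m
  \<comment> \<open>The degree of a pair. It recovers d from a member of \<open>basis D d\<close>,
    so the bijections of different degrees have disjoint ranges and \<open>b\<close> is
    injective.\<close>
  define tdeg where "tdeg = (\<lambda>(i, m). snd (D ! i) + mdeg m)"
  have basis_iff: "t \<in> basis D d \<longleftrightarrow> t \<in> B \<and> tdeg t = d" for t d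
    by (auto simp: basis_def B_def tdeg_def)
  have b_basis: "b m \<in> B \<and> tdeg (b m) = mdeg m" if "m \<in> A" for m
    using bij_betwE[OF \<beta>[of "mdeg m"]] that unfolding b_def by (auto simp: basis_iff)
  have b: "bij_betw b A B"
  proof (rule bij_betw_imageI)
    show "inj_on b A"
    proof (rule inj_onI)
      fix u v assume uv: "u \<in> A" "v \<in> A" "b u = b v"
      then have "mdeg u = mdeg v" using b_basis by metis
      then show "u = v"
        using uv \<beta>[of "mdeg u"] by (auto simp: b_def bij_betw_def inj_on_def)
    qed
    show "b ` A = B"
    proof (intro equalityI subsetI)
      fix t assume "t \<in> B"
      then have "t \<in> \<beta> (tdeg t) ` {m \<in> A. mdeg m = tdeg t}"
        using \<beta>[of "tdeg t"] by (simp add: bij_betw_def basis_iff)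
      then show "t \<in> b ` A" by (force simp: b_def)
    qed (use b_basis in auto)
  qed
  define c where "c = inv_into A b"
  have cb: "c (b m) = m" if "m \<in> A" for m
    unfolding c_def using b that by (simp add: bij_betw_inv_into_left)
  have bc: "b (c t) = t" and cA: "c t \<in> A" and cdeg: "mdeg (c t) = tdeg t" if "t \<in> B" for t
  proof -
    show 1: "b (c t) = t" unfolding c_def using b that by (simp add: bij_betw_inv_into_right)
    show 2: "c t \<in> A" unfolding c_def using b that by (metis bij_betw_imp_surj_on inv_into_into)
    show "mdeg (c t) = tdeg t" using b_basis[OF 2] 1 by simp
  qed
  define \<phi> :: "'k mpoly \<Rightarrow> nat \<Rightarrow> 'k mpoly" where
    "\<phi> p i = Abs_poly_mapping (\<lambda>m. if (i, m) \<in> B then Poly_Mapping.lookup p (c (i, m)) else 0)" for p i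
  define \<psi> :: "(nat \<Rightarrow> 'k mpoly) \<Rightarrow> 'k mpoly" where
    "\<psi> f = Abs_poly_mapping
      (\<lambda>m. if m \<in> A then Poly_Mapping.lookup (f (fst (b m))) (snd (b m)) else 0)" for f
  have look\<phi>: "Poly_Mapping.lookup (\<phi> p i) m =
      (if (i, m) \<in> B then Poly_Mapping.lookup p (c (i, m)) else 0)" for p i m
    unfolding \<phi>_def
  proof (subst lookup_Abs_poly_mapping)
    have "{m. (if (i, m) \<in> B then Poly_Mapping.lookup p (c (i, m)) else 0) \<noteq> 0}
        \<subseteq> (\<lambda>u. snd (b u)) ` Poly_Mapping.keys p"
    proof
      fix m assume "m \<in> {m. (if (i, m) \<in> B then Poly_Mapping.lookup p (c (i, m)) else 0) \<noteq> 0}"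
      then have "(i, m) \<in> B" "c (i, m) \<in> Poly_Mapping.keys p"
        by (auto simp: in_keys_iff split: if_splits)
      then show "m \<in> (\<lambda>u. snd (b u)) ` Poly_Mapping.keys p"
        by (intro image_eqI[of _ _ "c (i, m)"]) (simp_all add: bc)
    qed
    then show "finite {m. (if (i, m) \<in> B then Poly_Mapping.lookup p (c (i, m)) else 0) \<noteq> 0}"
      by (rule finite_subset) simp
  qed simp
  have look\<psi>: "Poly_Mapping.lookup (\<psi> f) m =
      (if m \<in> A then Poly_Mapping.lookup (f (fst (b m))) (snd (b m)) else 0)" for f m
    unfolding \<psi>_def
  proof (subst lookup_Abs_poly_mapping)
    \<comment> \<open>The family f is arbitrary here, but \<open>b\<close> only hits positions below
      \<open>length D\<close>; so finitely many polynomials contribute, and the support is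
      finite.\<close>
    have "m \<in> c ` (SIGMA i:{..<length D}. Poly_Mapping.keys (f i))"
      if "(if m \<in> A then Poly_Mapping.lookup (f (fst (b m))) (snd (b m)) else 0) \<noteq> 0" for m
    proof (rule image_eqI)
      have m: "m \<in> A" using that by (auto split: if_splits)
      then show "m = c (b m)" by (simp add: cb)
      have "b m \<in> B" using b_basis m by blast
      then have "fst (b m) < length D" by (auto simp: B_def basis_def)
      then show "b m \<in> (SIGMA i:{..<length D}. Poly_Mapping.keys (f i))"
        using that m by (simp add: in_keys_iff mem_Sigma_iff[of "fst (b m)" "snd (b m)", unfolded prod.collapse])
    qed
    then have "{m. (if m \<in> A then Poly_Mapping.lookup (f (fst (b m))) (snd (b m)) else 0) \<noteq> 0}
        \<subseteq> c ` (SIGMA i:{..<length D}. Poly_Mapping.keys (f i))" by blast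
    then show "finite {m. (if m \<in> A then Poly_Mapping.lookup (f (fst (b m))) (snd (b m)) else 0) \<noteq> 0}"
      by (rule finite_subset) (intro finite_imageI finite_SigmaI, auto)
  qed simp
  have dsum_iff: "f \<in> dsum D \<longleftrightarrow> (\<forall>i m. (i, m) \<notin> B \<longrightarrow> Poly_Mapping.lookup (f i) m = 0)"
    for f :: "nat \<Rightarrow> 'k mpoly"
    unfolding B_def by (rule mem_dsum_iff)
  have \<phi>: "\<phi> p \<in> dsum D" for p
    by (simp add: dsum_iff look\<phi>)
  have \<psi>: "\<psi> f \<in> supported_on A" for f
    by (simp add: supported_on_iff look\<psi>)
  have \<psi>\<phi>: "\<psi> (\<phi> p) = p" if "p \<in> supported_on A" for p
    using that b_basis cb by (intro poly_mapping_eqI) (simp add: look\<psi> look\<phi> supported_on_iff)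
  have \<phi>\<psi>: "\<phi> (\<psi> f) = f" if "f \<in> dsum D" for f
    using that cA bc
    by (intro ext poly_mapping_eqI) (simp add: look\<psi> look\<phi> dsum_iff)
  have part: "\<phi> p \<in> dsum_part D d \<longleftrightarrow> homogeneous d p" if p: "p \<in> supported_on A" for p d
  proof
    assume *: "\<phi> p \<in> dsum_part D d"
    show "homogeneous d p"
      unfolding homogeneous_def
    proof
      fix m assume m: "m \<in> Poly_Mapping.keys p"
      with p have "m \<in> A" by (auto simp: supported_on_def)
      with m have "Poly_Mapping.lookup (\<phi> p (fst (b m))) (snd (b m)) \<noteq> 0"
        by (simp add: look\<phi> b_basis cb in_keys_iff)
      with * have "b m \<in> basis D d" unfolding mem_dsum_part_iff by force
      then show "mdeg m = d" using b_basis[OF \<open>m \<in> A\<close>] by (simp add: basis_iff)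
    qed
  next
    assume "homogeneous d p"
    then show "\<phi> p \<in> dsum_part D d"
      by (auto simp: mem_dsum_part_iff look\<phi> basis_iff homogeneous_def) (metis cdeg in_keys_iff)
  qed
  have "graded_iso (supported_on A) D \<phi>"
    unfolding graded_iso_def
  proof (intro conjI allI ballI)
    show "bij_betw \<phi> (supported_on A) (dsum D)"
      by (rule bij_betw_byWitness[of _ \<psi>]) (auto simp: \<psi>\<phi> \<phi>\<psi> \<phi> \<psi>)
    show "\<phi> ` {p \<in> supported_on A. homogeneous d p} = dsum_part D d" for d
    proof (intro equalityI subsetI)
      fix f :: "nat \<Rightarrow> 'k mpoly" assume f: "f \<in> dsum_part D d"
      then have "\<phi> (\<psi> f) = f" by (intro \<phi>\<psi>) (simp add: dsum_part_def)
      then show "f \<in> \<phi> ` {p \<in> supported_on A. homogeneous d p}"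
        using f part[OF \<psi>, of f d] \<psi> by (intro image_eqI[of _ _ "\<psi> f"]) simp_all
    qed (auto simp: part)
  qed (auto intro!: poly_mapping_eqI simp: look\<phi> lookup_add lookup_smul)
  then show ?thesis by blast
qed

section \<open>Bounds for the Hilbert depth\<close>

lemma geometric_nth [simp]: "fps_nth geometric n = 1"
  by (simp add: geometric_def)

lemma geometric_mult_nth: "fps_nth (f * geometric) n = (\<Sum>i\<le>n. fps_nth f i)"
  by (simp add: fps_mult_nth atLeast0AtMost)

lemma geometric_power_nonneg: "0 \<le> fps_nth (geometric ^ c) n"
proof (induction c arbitrary: n)
  case (Suc c)
  then show ?case by (simp add: power_Suc2 geometric_mult_nth sum_nonneg del: power_Suc)
qed (simp add: fps_one_nth)

lemma geometric_power_nth_0: "fps_nth (geometric ^ c) 0 = 1"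
  by (simp add: fps_power_zeroth)

lemma geometric_power_nth_1: "fps_nth (geometric ^ c) (Suc 0) = int c"
proof (induction c)
  case (Suc c)
  then show ?case by (simp add: power_Suc2 geometric_mult_nth geometric_power_nth_0 del: power_Suc)
qed simp

text \<open>This is the binomial coefficient (c+1 choose 2), kept as a sum because multiplication by
  \<open>geometric\<close> turns the coefficients 1, c and 0 + ... + c into 0 + ... + (c+1).\<close>

lemma geometric_power_nth_2: "fps_nth (geometric ^ c) 2 = int (\<Sum>{..c})"
proof (induction c)
  case (Suc c)
  have "{..2::nat} = {0, 1, 2}" by auto
  with Suc show ?case
    by (simp add: power_Suc2 geometric_mult_nth geometric_power_nth_0 geometric_power_nth_1
        del: power_Suc)
qed simp

lemmas geometric_power_nth = geometric_power_nth_0 geometric_power_nth_1 geometric_power_nth_2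

lemma decomposition_series_nth:
  "fps_nth (decomposition_series D) d =
    (\<Sum>(Z, s)\<leftarrow>D. if d < s then 0 else fps_nth (geometric ^ card Z) (d - s))"
  by (induction D) (auto simp: decomposition_series_def fps_X_power_mult_nth)

text \<open>All contributions are nonnegative and a summand contributes 1 in the degree of its
  shift, so the vanishing in degrees 0 and 1 excludes the shifts 0 and 1. Shift 2 contributes 1 and
  then |Z|; a larger shift contributes nothing in degree 2.\<close>

lemma decomposition_series_bound:
  assumes "\<forall>(Z, s)\<in>set D. r \<le> card Z"
    and 0: "fps_nth (decomposition_series D) 0 = 0"
    and 1: "fps_nth (decomposition_series D) 1 = 0"
  shows "int r * fps_nth (decomposition_series D) 2 \<le> fps_nth (decomposition_series D) 3"
proof -
  define t :: "nat \<Rightarrow> nat set \<times> nat \<Rightarrow> int" where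
    "t d = (\<lambda>(Z, s). if d < s then 0 else fps_nth (geometric ^ card Z) (d - s))" for d
  have nth: "fps_nth (decomposition_series D) d = (\<Sum>x\<leftarrow>D. t d x)" for d
    by (simp add: decomposition_series_nth t_def)
  have nonneg: "0 \<le> t d x" for d x
    by (auto simp: t_def geometric_power_nonneg split: prod.split)
  have zero: "t d x = 0" if "x \<in> set D" "d = 0 \<or> d = 1" for d x
    using 0 1 that nonneg unfolding nth
    by (subst (asm) (1 2) sum_list_nonneg_eq_0_iff) auto
  have "int r * t 2 x \<le> t 3 x" if x: "x \<in> set D" for x
  proof -
    obtain Z s where x_eq: "x = (Z, s)" by (cases x)
    have "\<not> (s = 0 \<or> s = 1)"
    proof
      assume "s = 0 \<or> s = 1"
      from zero[OF x this] show False by (simp add: t_def x_eq geometric_power_nth)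
    qed
    then consider "s = 2" | "s > 2" by linarith
    then show ?thesis
    proof cases
      case 1
      then show ?thesis
        using assms(1) x by (auto simp: t_def x_eq geometric_power_nth eval_nat_numeral)
    next
      case 2
      then show ?thesis using nonneg[of 3 x] by (simp add: t_def x_eq)
    qed
  qed
  then have "(\<Sum>x\<leftarrow>D. int r * t 2 x) \<le> (\<Sum>x\<leftarrow>D. t 3 x)"
    by (rule sum_list_mono)
  then show ?thesis by (simp add: nth sum_list_const_mult)
qed

section \<open>From Hilbert series to Hilbert depth\<close>

lemma graded_ideal_Idl_mon:
  assumes "M \<subseteq> monomials {1..n}"
  shows "graded_ideal n (Idl\<^bsub>poly_ring n\<^esub> (mon ` M) :: 'k::field mpoly set)"
  unfolding graded_ideal_def
proof (intro conjI exI[of _ "mon ` M"])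
  show "ideal (Idl\<^bsub>poly_ring n\<^esub> (mon ` M) :: 'k mpoly set) (poly_ring n)"
    unfolding Idl_mon_eq[OF assms] by (rule supported_on_upset_ideal)
qed (use assms in \<open>auto simp: polys_def homogeneous_def\<close>)

text \<open>\<open>h3\<close> contradicts \<open>decomposition_series_bound\<close> for r + 1, so no
  decomposition has depth above r, while \<open>D\<close> is one of depth at least r.\<close>

lemma hdepth_eqI:
  fixes I :: "'k::field mpoly set"
  assumes M: "M \<subseteq> monomials {1..n}" and I: "I = Idl\<^bsub>poly_ring n\<^esub> (mon ` M)"
    and D: "\<forall>(Z, s)\<in>set D. Z \<subseteq> {1..n} \<and> r \<le> card Z"
    and series: "hilbert_series (upset n M) = decomposition_series D"
    and h0: "fps_nth (hilbert_series (upset n M)) 0 = 0"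
    and h1: "fps_nth (hilbert_series (upset n M)) 1 = 0"
    and h3: "fps_nth (hilbert_series (upset n M)) 3 < int (Suc r) * fps_nth (hilbert_series (upset n M)) 2"
  shows "hdepth n I = r"
proof -
  let ?h = "hilbert_series (upset n M)"
  have I': "I = supported_on (upset n M)" by (simp add: I Idl_mon_eq[OF M])
  \<comment> \<open>\<open>Min\<close> says nothing about an empty list. The strict inequality
    \<open>h3\<close> rules out the zero series, and with it the empty list.\<close>
  have ne: "D' \<noteq> []" if "?h = decomposition_series D'" for D'
    using h3 that by (auto simp: decomposition_series_def)
  have Min_le: "hdepth_decomposition D' \<le> card Z" if "(Z, s) \<in> set D'" for D' :: "(nat set \<times> nat) list" and Z s
    unfolding hdepth_decomposition_def using that by (intro Min_le) force+
  have upper: "hdepth_decomposition D' \<le> r" if D': "hilbert_decomposition n I D'" for D'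
  proof (rule ccontr)
    assume "\<not> hdepth_decomposition D' \<le> r"
    then have card: "\<forall>(Z, s)\<in>set D'. Suc r \<le> card Z"
      using Min_le by fastforce
    obtain \<phi> where "graded_iso (supported_on (upset n M) :: 'k mpoly set) D' \<phi>"
      using D' by (auto simp: hilbert_decomposition_def I')
    moreover have "\<forall>(Z, s)\<in>set D'. Z \<subseteq> {1..n}"
      using D' by (simp add: hilbert_decomposition_def)
    then have "\<forall>(Z, s)\<in>set D'. finite Z"
      by (force intro: finite_subset[OF _ finite_atLeastAtMost])
    ultimately have "?h = decomposition_series D'"
      by (intro graded_iso_imp_series_eq[OF upset_subset_monomials]) auto
    with decomposition_series_bound[OF card] h0 h1 h3 show False by simp
  qed
  have dec: "hilbert_decomposition n I D"
  proof -
    have "\<forall>(Z, s)\<in>set D. finite Z"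
      using D by (force intro: finite_subset[OF _ finite_atLeastAtMost])
    with series_eq_imp_graded_iso[OF upset_subset_monomials _ _ series]
    have "\<exists>\<phi>. graded_iso I D \<phi>" by (auto simp: I')
    then show ?thesis
      using D graded_ideal_Idl_mon[OF M] by (auto simp: hilbert_decomposition_def I)
  qed
  have "r \<le> hdepth_decomposition D"
    unfolding hdepth_decomposition_def using ne[OF series] D by (subst Min_ge_iff) auto
  with upper[OF dec] have r: "hdepth_decomposition D = r" by simp
  show ?thesis
    unfolding hdepth_def
  proof (rule Max_eqI)
    show "finite (hdepth_decomposition ` {D. hilbert_decomposition n I D})"
      by (rule finite_subset[of _ "{..r}"]) (use upper in auto)
    show "r \<in> hdepth_decomposition ` {D. hilbert_decomposition n I D}"
      using dec r by blast
  qed (use upper in auto)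
qed

section \<open>Ideals generated by quadratic monomials\<close>

definition quad :: "nat \<Rightarrow> nat \<Rightarrow> nat \<Rightarrow>\<^sub>0 nat" where
  "quad i j = Poly_Mapping.single i 1 + Poly_Mapping.single j 1"

lemma lookup_quad:
  "Poly_Mapping.lookup (quad i j) k = (if k = i then 1 else 0) + (if k = j then 1 else 0)"
  by (simp add: quad_def lookup_add lookup_single when_def)

lemma mdeg_quad [simp]: "mdeg (quad i j) = 2"
  by (simp add: quad_def mdeg_add)

lemma quad_in_monomials: "i \<in> Z \<Longrightarrow> j \<in> Z \<Longrightarrow> quad i j \<in> monomials Z"
  unfolding quad_def by (intro monomials_add single_in_monomials)

lemma divides_quad_iff:
  "divides (quad i j) m \<longleftrightarrow>
    1 \<le> Poly_Mapping.lookup m i \<and> 1 \<le> Poly_Mapping.lookup m j \<and> (i = j \<longrightarrow> 2 \<le> Poly_Mapping.lookup m i)"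
proof
  assume "divides (quad i j) m"
  then have le: "Poly_Mapping.lookup (quad i j) k \<le> Poly_Mapping.lookup m k" for k
    by (simp add: divides_def)
  from le[of i] le[of j]
  show "1 \<le> Poly_Mapping.lookup m i \<and> 1 \<le> Poly_Mapping.lookup m j \<and> (i = j \<longrightarrow> 2 \<le> Poly_Mapping.lookup m i)"
    by (auto simp: lookup_quad split: if_splits)
qed (auto simp: divides_def lookup_quad)

lemma mem_upset_iff: "m \<in> upset n M \<longleftrightarrow> m \<in> monomials {1..n} \<and> (\<exists>g\<in>M. divides g m)"
  by (simp add: upset_def)

lemma divides_imp_mdeg_le: "divides g m \<Longrightarrow> mdeg g \<le> mdeg m"
proof -
  assume "divides g m"
  then have "m = g + (m - g)"
    by (intro poly_mapping_eqI) (simp add: divides_def lookup_add minus_poly_mapping.rep_eq)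
  then have "mdeg m = mdeg g + mdeg (m - g)" by (metis mdeg_add)
  then show ?thesis by simp
qed

lemma image_add_monomials:
  "(+) u ` monomials Z =
    {m. divides u m \<and> (\<forall>i. i \<notin> Z \<longrightarrow> Poly_Mapping.lookup m i = Poly_Mapping.lookup u i)}"
proof (intro equalityI subsetI)
  fix m assume m: "m \<in> {m. divides u m \<and> (\<forall>i. i \<notin> Z \<longrightarrow> Poly_Mapping.lookup m i = Poly_Mapping.lookup u i)}"
  then have "m = u + (m - u)"
    by (intro poly_mapping_eqI) (simp add: divides_def lookup_add minus_poly_mapping.rep_eq)
  moreover have "m - u \<in> monomials Z"
    using m by (simp add: monomials_iff minus_poly_mapping.rep_eq)
  ultimately show "m \<in> (+) u ` monomials Z" by blast
qed (auto simp: divides_def lookup_add monomials_iff)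

section \<open>The lex condition\<close>

lemma lex_less_lookup_le:
  fixes u v :: "nat \<Rightarrow>\<^sub>0 nat"
  assumes "u < v" "\<And>j. j < k \<Longrightarrow> Poly_Mapping.lookup u j = Poly_Mapping.lookup v j"
  shows "Poly_Mapping.lookup u k \<le> Poly_Mapping.lookup v k"
proof -
  obtain l where l: "Poly_Mapping.lookup u l < Poly_Mapping.lookup v l"
    "\<And>j. j < l \<Longrightarrow> Poly_Mapping.lookup u j = Poly_Mapping.lookup v j"
    using assms(1) unfolding less_poly_mapping.rep_eq by (auto elim!: less_funE)
  then show ?thesis
    using assms(2)[of l] by (cases k l rule: linorder_cases) auto
qed

text \<open>Covers both kinds of lex ideals, with \<open>Q\<close> the set of all or of squarefree
  monomials. If x_1 divides v, the degree decides. Otherwise x_1 divides neither monomial, and the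
  comparison moves on to x_2, x_3, x_4, the only variables in the remaining generators of the four
  ideals; \<open>tail\<close> isolates this part.\<close>

lemma lex_upset:
  assumes J: "{2..n} \<subseteq> J" and Q: "1 \<in> J \<or> Q \<subseteq> squarefree_monomials"
    and tail: "\<And>u v. u \<in> monomials {1..n} \<inter> Q \<Longrightarrow> v \<in> monomials {1..n} \<inter> Q \<Longrightarrow>
      Poly_Mapping.lookup u 2 \<le> Poly_Mapping.lookup v 2 \<Longrightarrow>
      (Poly_Mapping.lookup u 2 = Poly_Mapping.lookup v 2 \<longrightarrow>
        Poly_Mapping.lookup u 3 \<le> Poly_Mapping.lookup v 3) \<Longrightarrow>
      (Poly_Mapping.lookup u 2 = Poly_Mapping.lookup v 2 \<and>
        Poly_Mapping.lookup u 3 = Poly_Mapping.lookup v 3 \<longrightarrow>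
        Poly_Mapping.lookup u 4 \<le> Poly_Mapping.lookup v 4) \<Longrightarrow>
      \<exists>g\<in>R. divides g u \<Longrightarrow> \<exists>g\<in>R. divides g v"
    and R: "\<And>g. g \<in> R \<Longrightarrow> mdeg g = 2"
    and u: "u \<in> upset n (quad 1 ` J \<union> R) \<inter> Q" and v: "v \<in> monomials {1..n} \<inter> Q"
    and "mdeg v = mdeg u" "u < v"
  shows "v \<in> upset n (quad 1 ` J \<union> R)"
proof -
  have u': "u \<in> monomials {1..n}" using u by (simp add: mem_upset_iff)
  have le: "\<And>k. \<forall>j<k. Poly_Mapping.lookup u j = Poly_Mapping.lookup v j \<Longrightarrow>
      Poly_Mapping.lookup u k \<le> Poly_Mapping.lookup v k"
    using lex_less_lookup_le[OF \<open>u < v\<close>] by blast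
  \<comment> \<open>Variables start at index 1, but the order on exponent vectors compares index 0
    first.\<close>
  have eq0: "Poly_Mapping.lookup u 0 = Poly_Mapping.lookup v 0"
    using u' v by (simp add: monomials_iff)
  have "\<exists>g\<in>quad 1 ` J \<union> R. divides g v"
  proof (cases "Poly_Mapping.lookup v 1 = 0")
    case True
    with le[of 1] eq0 have u1: "Poly_Mapping.lookup u 1 = 0" by simp
    have "\<exists>g\<in>R. divides g v"
    proof (rule tail)
      show "\<exists>g\<in>R. divides g u" using u u1 by (auto simp: mem_upset_iff divides_quad_iff)
      show "Poly_Mapping.lookup u 2 \<le> Poly_Mapping.lookup v 2"
      proof (intro impI le allI)
        fix j assume "j < (2::nat)"
        then have "j = 0 \<or> j = 1" by linarith
        then show "Poly_Mapping.lookup u j = Poly_Mapping.lookup v j"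
          using eq0 u1 True by (elim disjE) simp_all
      qed
      show "Poly_Mapping.lookup u 2 = Poly_Mapping.lookup v 2 \<longrightarrow>
        Poly_Mapping.lookup u 3 \<le> Poly_Mapping.lookup v 3"
      proof (intro impI le allI)
        fix j assume eq: "Poly_Mapping.lookup u 2 = Poly_Mapping.lookup v 2" and "j < (3::nat)"
        then have "j = 0 \<or> j = 1 \<or> j = 2" by linarith
        then show "Poly_Mapping.lookup u j = Poly_Mapping.lookup v j"
          using eq0 u1 True eq by (elim disjE) simp_all
      qed
      show "Poly_Mapping.lookup u 2 = Poly_Mapping.lookup v 2 \<and> Poly_Mapping.lookup u 3 = Poly_Mapping.lookup v 3 \<longrightarrow>
        Poly_Mapping.lookup u 4 \<le> Poly_Mapping.lookup v 4"
      proof (intro impI le allI)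
        fix j assume eq: "Poly_Mapping.lookup u 2 = Poly_Mapping.lookup v 2 \<and> Poly_Mapping.lookup u 3 = Poly_Mapping.lookup v 3" and "j < (4::nat)"
        then have "j = 0 \<or> j = 1 \<or> j = 2 \<or> j = 3" by linarith
        then show "Poly_Mapping.lookup u j = Poly_Mapping.lookup v j"
          using eq0 u1 True eq by (elim disjE) simp_all
      qed
    qed (use u u' v in auto)
    then show ?thesis by blast
  next
    case False
    have "2 \<le> mdeg v"
      using u R \<open>mdeg v = mdeg u\<close> divides_imp_mdeg_le[of _ u]
      by (fastforce simp: mem_upset_iff)
    show ?thesis
    proof (cases "\<exists>j\<in>{2..n}. Poly_Mapping.lookup v j \<noteq> 0")
      case True
      then obtain j where "j \<in> {2..n}" "Poly_Mapping.lookup v j \<noteq> 0" by blast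
      with False J show ?thesis
        by (intro bexI[of _ "quad 1 j"]) (auto simp: divides_quad_iff)
    next
      \<comment> \<open>Here v is a power of x_1 with exponent at least 2. It is not squarefree, so
        x_1^2 must be among the generators.\<close>
      case no: False
      have "mdeg v = (\<Sum>i\<in>{1}. Poly_Mapping.lookup v i)"
      proof (rule mdeg_eq_sum)
        show "Poly_Mapping.keys v \<subseteq> {1}"
        proof
          fix i assume i: "i \<in> Poly_Mapping.keys v"
          then have "i \<in> {1..n}" using v by (auto simp: monomials_def)
          moreover have "i \<notin> {2..n}" using i no by (auto simp: in_keys_iff)
          ultimately show "i \<in> {1}" by auto
        qed
      qed simp
      with \<open>2 \<le> mdeg v\<close> have v1: "2 \<le> Poly_Mapping.lookup v 1" by simp
      then have "v \<notin> squarefree_monomials"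
        by (auto simp: squarefree_monomials_def not_le intro!: exI[of _ 1])
      with Q v have "1 \<in> J" by blast
      with v1 show ?thesis by (intro bexI[of _ "quad 1 1"]) (auto simp: divides_quad_iff)
    qed
  qed
  with v show ?thesis by (simp add: mem_upset_iff)
qed

text \<open>The monomials divisible by x_1 are x_1 w with w involving a variable from
  \<open>J\<close>; because 2 is in \<open>J\<close>, this includes the multiples of x_1 x_2 x_a.
  Those without x_1 form the cone over x_2 x_a in the variables x_2, ..., x_n.\<close>

lemma hilbert_series_upset_quad:
  assumes J: "J \<subseteq> {1..n}" "2 \<in> J" and a: "a \<in> {2..n}"
  shows "hilbert_series (upset n (quad 1 ` J \<union> {quad 2 a})) =
    fps_X * (geometric ^ n - geometric ^ (n - card J)) + fps_X ^ 2 * geometric ^ (n - 1)"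
proof -
  let ?N = "monomials {1..n}" and ?N' = "monomials ({1..n} - J)"
  let ?x = "Poly_Mapping.single 1 1 :: nat \<Rightarrow>\<^sub>0 nat"
  have sub: "?N' \<subseteq> ?N" by (rule monomials_mono) auto
  have "upset n (quad 1 ` J \<union> {quad 2 a}) = (+) ?x ` (?N - ?N') \<union> (+) (quad 2 a) ` monomials {2..n}"
  proof (intro equalityI subsetI)
    fix m assume m: "m \<in> upset n (quad 1 ` J \<union> {quad 2 a})"
    show "m \<in> (+) ?x ` (?N - ?N') \<union> (+) (quad 2 a) ` monomials {2..n}"
    proof (cases "Poly_Mapping.lookup m 1 = 0")
      case True
      with m have "divides (quad 2 a) m" and mN: "m \<in> ?N"
        by (auto simp: mem_upset_iff divides_quad_iff)
      moreover have "Poly_Mapping.lookup m i = Poly_Mapping.lookup (quad 2 a) i" if i: "i \<notin> {2..n}" for i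
      proof -
        have "i = 1 \<or> i \<notin> {1..n}" using i by auto
        with True mN have "Poly_Mapping.lookup m i = 0" by (auto simp: monomials_iff)
        moreover have "i \<noteq> 2" "i \<noteq> a" using i a by auto
        ultimately show ?thesis by (simp add: lookup_quad)
      qed
      ultimately show ?thesis by (simp add: image_add_monomials)
    next
      case False
      then have eq: "m = ?x + (m - ?x)"
        by (intro poly_mapping_eqI) (auto simp: lookup_add minus_poly_mapping.rep_eq lookup_single when_def)
      obtain j where j: "j \<in> J" "divides (quad 1 j) m"
        using m False J(2) by (auto simp: mem_upset_iff divides_quad_iff)
      then have "m - ?x \<notin> ?N'"
        by (auto simp: monomials_iff minus_poly_mapping.rep_eq lookup_single when_def divides_quad_iff
            intro!: exI[of _ j])
      moreover have "m - ?x \<in> ?N"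
        using m by (auto simp: mem_upset_iff monomials_iff minus_poly_mapping.rep_eq)
      ultimately show ?thesis using eq by blast
    qed
  next
    fix m assume "m \<in> (+) ?x ` (?N - ?N') \<union> (+) (quad 2 a) ` monomials {2..n}"
    then show "m \<in> upset n (quad 1 ` J \<union> {quad 2 a})"
    proof
      assume "m \<in> (+) ?x ` (?N - ?N')"
      then obtain w where w: "m = ?x + w" "w \<in> ?N" "w \<notin> ?N'" by auto
      then obtain j where "j \<in> J" "Poly_Mapping.lookup w j \<noteq> 0"
        by (auto simp: monomials_iff)
      moreover have "m \<in> ?N" using w J by (auto intro!: monomials_add single_in_monomials)
      ultimately show ?thesis
        using w by (auto simp: mem_upset_iff divides_quad_iff lookup_add lookup_single when_def
            intro!: bexI[of _ j])
    next
      assume "m \<in> (+) (quad 2 a) ` monomials {2..n}"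
      then obtain w where w: "m = quad 2 a + w" "w \<in> monomials {2..n}" by auto
      have "w \<in> ?N" using w(2) monomials_mono[of "{2..n}" "{1..n}"] by auto
      moreover have "quad 2 a \<in> ?N" using a by (intro quad_in_monomials) auto
      ultimately show ?thesis
        using w by (auto simp: mem_upset_iff divides_def lookup_add intro!: monomials_add)
    qed
  qed
  also have "hilbert_series \<dots> =
      hilbert_series ((+) ?x ` (?N - ?N')) + hilbert_series ((+) (quad 2 a) ` monomials {2..n})"
  proof (rule hilbert_series_Un)
    show "(+) ?x ` (?N - ?N') \<subseteq> ?N"
      using J by (auto intro!: monomials_add single_in_monomials)
    show "(+) (quad 2 a) ` monomials {2..n} \<subseteq> ?N"
      using a monomials_mono[of "{2..n}" "{1..n}"] by (auto intro!: monomials_add quad_in_monomials)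
    have "Poly_Mapping.lookup m 1 \<noteq> 0" if "m \<in> (+) ?x ` (?N - ?N')" for m
      using that by (auto simp: lookup_add)
    moreover have "Poly_Mapping.lookup m 1 = 0" if "m \<in> (+) (quad 2 a) ` monomials {2..n}" for m
      using that a by (auto simp: lookup_add lookup_quad monomials_iff)
    ultimately show "(+) ?x ` (?N - ?N') \<inter> (+) (quad 2 a) ` monomials {2..n} = {}" by blast
  qed simp
  also have "hilbert_series ((+) ?x ` (?N - ?N')) = fps_X * hilbert_series (?N - ?N')"
    by (simp add: hilbert_series_shift)
  also have "hilbert_series (?N - ?N') = geometric ^ n - geometric ^ (n - card J)"
  proof -
    have "hilbert_series ((?N - ?N') \<union> ?N') = hilbert_series (?N - ?N') + hilbert_series ?N'"
      using sub by (intro hilbert_series_Un) auto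
    moreover have "(?N - ?N') \<union> ?N' = ?N" using sub by auto
    moreover have "card ({1..n} - J) = n - card J"
      using J finite_subset[OF J(1)] by (simp add: card_Diff_subset)
    ultimately show ?thesis by (simp add: hilbert_series_monomials)
  qed
  also have "hilbert_series ((+) (quad 2 a) ` monomials {2..n}) = fps_X ^ 2 * geometric ^ (n - 1)"
    by (simp add: hilbert_series_shift hilbert_series_monomials)
  finally show ?thesis .
qed

text \<open>A new monomial is a multiple of x_2 x_b but not of x_1 x_2 or x_2 x_a. For a = 2 this
  fixes the exponent of x_2 at 1, for other a it forbids x_a. Either way the exponent of x_a is that
  in x_2 x_b, so the new monomials form a cone in n - 2 variables.\<close>

lemma hilbert_series_upset_quad2:
  assumes J: "J \<subseteq> {1..n}" "2 \<in> J" and a: "a \<in> {2..n}" and b: "b \<in> {3..n}" "a \<noteq> b"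
  shows "hilbert_series (upset n (quad 1 ` J \<union> {quad 2 a, quad 2 b})) =
    fps_X * (geometric ^ n - geometric ^ (n - card J)) + fps_X ^ 2 * geometric ^ (n - 1) +
    fps_X ^ 2 * geometric ^ (n - 2)"
proof -
  let ?U = "upset n (quad 1 ` J \<union> {quad 2 a})"
  let ?V = "(+) (quad 2 b) ` monomials ({2..n} - {a})"
  have V: "?V = {m. divides (quad 2 b) m \<and>
      (\<forall>i. i \<notin> {2..n} - {a} \<longrightarrow> Poly_Mapping.lookup m i = Poly_Mapping.lookup (quad 2 b) i)}"
    by (rule image_add_monomials)
  have V_sub: "?V \<subseteq> monomials {1..n}"
    using b subsetD[OF monomials_mono[of "{2..n} - {a}" "{1..n}"]]
    by (fastforce intro: monomials_add quad_in_monomials)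
  have mem_V: "m \<in> ?V"
    if m: "m \<in> monomials {1..n}" "divides (quad 2 b) m" "m \<notin> ?U" for m
  proof -
    have "\<not> divides (quad 2 a) m" "\<not> divides (quad 1 2) m"
      using m J by (auto simp: mem_upset_iff)
    with m(2) have m1: "Poly_Mapping.lookup m 1 = 0" "a = 2 \<Longrightarrow> Poly_Mapping.lookup m 2 = 1"
      "a \<noteq> 2 \<Longrightarrow> Poly_Mapping.lookup m a = 0"
      by (auto simp: divides_quad_iff)
    have "Poly_Mapping.lookup m i = Poly_Mapping.lookup (quad 2 b) i" if i: "i \<notin> {2..n} - {a}" for i
    proof -
      consider "i = a" | "i = 1" "i \<noteq> a" | "i \<notin> {1..n}" using i by fastforce
      then show ?thesis
        using m1 a b m(1) by cases (auto simp: lookup_quad monomials_iff)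
    qed
    with m(2) show ?thesis by (simp add: V)
  qed
  have "upset n (quad 1 ` J \<union> {quad 2 a, quad 2 b}) = ?U \<union> ?V"
  proof (intro equalityI subsetI)
    fix m assume "m \<in> upset n (quad 1 ` J \<union> {quad 2 a, quad 2 b})"
    then show "m \<in> ?U \<union> ?V" using mem_V[of m] by (auto simp: mem_upset_iff)
  next
    fix m assume "m \<in> ?U \<union> ?V"
    moreover have "divides (quad 2 b) m" if "m \<in> ?V" using that unfolding V by blast
    ultimately show "m \<in> upset n (quad 1 ` J \<union> {quad 2 a, quad 2 b})"
      using V_sub by (auto simp: mem_upset_iff)
  qed
  also have "hilbert_series \<dots> = hilbert_series ?U + hilbert_series ?V"
  proof (rule hilbert_series_Un)
    show "?U \<subseteq> monomials {1..n}" by (rule upset_subset_monomials)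
    show "?V \<subseteq> monomials {1..n}" by (rule V_sub)
    have "m \<notin> ?U" if m: "m \<in> ?V" for m
    proof -
      have eq: "\<forall>i. i \<notin> {2..n} - {a} \<longrightarrow> Poly_Mapping.lookup m i = Poly_Mapping.lookup (quad 2 b) i"
        using m unfolding V by blast
      have "Poly_Mapping.lookup m 1 = 0" "Poly_Mapping.lookup m a = (if a = 2 then 1 else 0)"
        using eq[rule_format, of 1] eq[rule_format, of a] a b
        by (auto simp: lookup_quad)
      then show ?thesis by (auto simp: mem_upset_iff divides_quad_iff)
    qed
    then show "?U \<inter> ?V = {}" by blast
  qed simp
  also have "hilbert_series ?V = fps_X ^ 2 * geometric ^ (n - 2)"
    using a by (simp add: hilbert_series_shift hilbert_series_monomials numeral_2_eq_2)
  finally show ?thesis using hilbert_series_upset_quad[OF J a] by simp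
qed

section \<open>Numerical decompositions\<close>

lemma quads_subset_monomials:
  assumes "J \<subseteq> {1..n}" "a \<in> {2..n}" "b \<in> {2..n}"
  shows "quad 1 ` J \<union> {quad 2 a, quad 2 b} \<subseteq> monomials {1..n}"
  using assms by (auto intro!: quad_in_monomials)

text \<open>An entry \<open>(c, k, s)\<close> stands for \<open>c\<close> summands \<open>K[x\<^sub>1,\<dots>,x\<^bsub>k+e\<^esub>](-s)\<close>. Taking \<open>e = 0\<close>
  for the lex ideals and \<open>e = 1\<close> for the squarefree ones treats both cases at once, because the Hilbert
  series of \<open>L\<^sub>i\<^sup>\<sigma>\<close> is that of \<open>L\<^sub>i\<close> divided by \<open>1 - t\<close>.\<close>

definition summands :: "nat \<Rightarrow> (nat \<times> nat \<times> nat) list \<Rightarrow> (nat set \<times> nat) list" where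
  "summands e T = concat (map (\<lambda>(c, k, s). replicate c ({1..k + e}, s)) T)"

lemma decomposition_series_summands:
  "decomposition_series (summands e T) =
    (\<Sum>(c, k, s)\<leftarrow>T. of_nat c * fps_X ^ s * geometric ^ k) * geometric ^ e"
  by (induction T)
    (auto simp: summands_def decomposition_series_def sum_list_replicate power_add algebra_simps)

lemma summands_subset:
  assumes "\<forall>(c, k, s)\<in>set T. r \<le> k \<and> k + e \<le> n"
  shows "\<forall>(Z, s)\<in>set (summands e T). Z \<subseteq> {1..n} \<and> r + e \<le> card Z"
  using assms by (fastforce simp: summands_def)

text \<open>The sum up to e cancels against the coefficient of \<open>geometric ^ e\<close>, which
  leaves an inequality linear in e.\<close>

lemma sum_atMost_10_plus: "(\<Sum>{..10 + e}) = (\<Sum>{..e}) + 10 * e + (55::nat)"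
  by (simp add: eval_nat_numeral)

text \<open>Serves to write all powers of p over the common denominator (1 - x)^10.\<close>

lemma power_eq_geometric_mult:
  fixes x p :: "'a::comm_ring_1"
  assumes "(1 - x) * p = 1" "k \<le> n"
  shows "p ^ k = p ^ n * (1 - x) ^ (n - k)"
proof -
  have "p ^ n = p ^ k * p ^ (n - k)"
    using assms(2) by (simp flip: power_add)
  then have "p ^ n * (1 - x) ^ (n - k) = p ^ k * ((1 - x) * p) ^ (n - k)"
    by (simp add: power_mult_distrib mult_ac)
  with assms(1) show ?thesis by simp
qed

text \<open>With \<open>p = 1 / (1 - x)\<close> and \<open>r\<close> the depth, the coefficients below come from expanding
  \<open>(1 - x)\<^sup>r\<close> times the left-hand side up to the degree where \<open>(1 - x)\<^sup>r\<close> ends, and then rewriting the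
  remainders of the series \<open>p\<^sup>k\<close> with \<open>p\<^sup>k = p\<^bsup>k-1\<^esup> + x p\<^sup>k\<close>.\<close>

lemma geometric_identity:
  fixes x p :: "'a::idom"
  assumes "(1 - x) * p = 1"
  shows "x * (p ^ 10 - 1) = 10 * x ^ 2 * p ^ 5 + 5 * x ^ 3 * p ^ 5 + 45 * x ^ 4 * p ^ 5 +
    65 * x ^ 5 * p ^ 5 + 127 * x ^ 6 * p ^ 5 + 126 * x ^ 7 * p ^ 6 + 56 * x ^ 7 * p ^ 7 +
    21 * x ^ 7 * p ^ 8 + 6 * x ^ 7 * p ^ 9 + x ^ 7 * p ^ 10"
proof -
  note pow = power_eq_geometric_mult[OF assms, of _ 10]
  have "1 = p ^ 10 * (1 - x) ^ 10" "p ^ 5 = p ^ 10 * (1 - x) ^ 5" "p ^ 6 = p ^ 10 * (1 - x) ^ 4"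
    "p ^ 7 = p ^ 10 * (1 - x) ^ 3" "p ^ 8 = p ^ 10 * (1 - x) ^ 2" "p ^ 9 = p ^ 10 * (1 - x)"
    using pow[of 0] pow[of 5] pow[of 6] pow[of 7] pow[of 8] pow[of 9] by simp_all
  \<comment> \<open>With P as an independent variable, what remains is a polynomial identity in x
    and P.\<close>
  moreover define P where "P = p ^ 10"
  moreover have "x * (P - P * (1 - x) ^ 10) = 10 * x ^ 2 * (P * (1 - x) ^ 5) +
      5 * x ^ 3 * (P * (1 - x) ^ 5) + 45 * x ^ 4 * (P * (1 - x) ^ 5) +
      65 * x ^ 5 * (P * (1 - x) ^ 5) + 127 * x ^ 6 * (P * (1 - x) ^ 5) +
      126 * x ^ 7 * (P * (1 - x) ^ 4) + 56 * x ^ 7 * (P * (1 - x) ^ 3) +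
      21 * x ^ 7 * (P * (1 - x) ^ 2) + 6 * x ^ 7 * (P * (1 - x)) + x ^ 7 * P"
    by Groebner_Basis.algebra \<comment> \<open>HOL-Algebra has another method of this name\<close>
  ultimately show ?thesis by metis
qed

lemma geometric_identity2:
  fixes x p :: "'a::idom"
  assumes "(1 - x) * p = 1"
  shows "x * (p ^ 10 - 1) + x ^ 2 * p ^ 9 + x ^ 2 * p ^ 8 =
    12 * x ^ 2 * p ^ 6 + 40 * x ^ 4 * p ^ 6 + 20 * x ^ 5 * p ^ 6 + 62 * x ^ 6 * p ^ 6 +
    83 * x ^ 7 * p ^ 6 + 5 * x ^ 4 * p ^ 7 + 3 * x ^ 4 * p ^ 8 + x ^ 4 * p ^ 9 +
    84 * x ^ 8 * p ^ 7 + 28 * x ^ 8 * p ^ 8 + 7 * x ^ 8 * p ^ 9 + x ^ 8 * p ^ 10"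
proof -
  note pow = power_eq_geometric_mult[OF assms, of _ 10]
  have "1 = p ^ 10 * (1 - x) ^ 10" "p ^ 6 = p ^ 10 * (1 - x) ^ 4"
    "p ^ 7 = p ^ 10 * (1 - x) ^ 3" "p ^ 8 = p ^ 10 * (1 - x) ^ 2" "p ^ 9 = p ^ 10 * (1 - x)"
    using pow[of 0] pow[of 6] pow[of 7] pow[of 8] pow[of 9] by simp_all
  moreover define P where "P = p ^ 10"
  moreover have "x * (P - P * (1 - x) ^ 10) + x ^ 2 * (P * (1 - x)) + x ^ 2 * (P * (1 - x) ^ 2) =
      12 * x ^ 2 * (P * (1 - x) ^ 4) + 40 * x ^ 4 * (P * (1 - x) ^ 4) +
      20 * x ^ 5 * (P * (1 - x) ^ 4) + 62 * x ^ 6 * (P * (1 - x) ^ 4) +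
      83 * x ^ 7 * (P * (1 - x) ^ 4) + 5 * x ^ 4 * (P * (1 - x) ^ 3) +
      3 * x ^ 4 * (P * (1 - x) ^ 2) + x ^ 4 * (P * (1 - x)) + 84 * x ^ 8 * (P * (1 - x) ^ 3) +
      28 * x ^ 8 * (P * (1 - x) ^ 2) + 7 * x ^ 8 * (P * (1 - x)) + x ^ 8 * P"
    by Groebner_Basis.algebra
  ultimately show ?thesis by metis
qed

lemma hdepth_quad:
  assumes J: "J \<subseteq> {1..10 + e}" "card J = 10" "2 \<in> J" and a: "a \<in> {2..10 + e}"
  shows "hdepth (10 + e) (Idl\<^bsub>poly_ring (10 + e)\<^esub> (mon ` (quad 1 ` J \<union> {quad 2 a}))
    :: 'k::field mpoly set) = 5 + e"
proof (rule hdepth_eqI[OF _ refl])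
  \<comment> \<open>The last entry is the cone over x_2 x_a. The others decompose the multiples of
    x_1, whose series is t times that of the maximal ideal in ten variables, up to the factor
    \<open>geometric ^ e\<close>.\<close>
  let ?T = "[(10, 5, 2), (5, 5, 3), (45, 5, 4), (65, 5, 5), (127, 5, 6), (126, 6, 7), (56, 7, 7),
    (21, 8, 7), (6, 9, 7), (1, 10, 7), (1, 9, 2)] :: (nat \<times> nat \<times> nat) list"
  let ?M = "quad 1 ` J \<union> {quad 2 a}"
  have h: "hilbert_series (upset (10 + e) ?M) =
      fps_X * (geometric ^ (10 + e) - geometric ^ e) + fps_X ^ 2 * geometric ^ (9 + e)"
    using hilbert_series_upset_quad[OF J(1,3) a] J(2) by simp
  show "?M \<subseteq> monomials {1..10 + e}"
    using quads_subset_monomials[OF J(1) a a] by simp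
  show "\<forall>(Z, s)\<in>set (summands e ?T). Z \<subseteq> {1..10 + e} \<and> 5 + e \<le> card Z"
    by (rule summands_subset) simp
  have "hilbert_series (upset (10 + e) ?M) =
      (fps_X * (geometric ^ 10 - 1) + fps_X ^ 2 * geometric ^ 9) * geometric ^ e"
    unfolding h by (simp add: power_add algebra_simps)
  also have "fps_X * (geometric ^ 10 - 1) + fps_X ^ 2 * geometric ^ 9 =
      (\<Sum>(c, k, s)\<leftarrow>?T. of_nat c * fps_X ^ s * geometric ^ k)"
    using geometric_identity[OF geometric_mult] by (simp add: algebra_simps)
  finally show "hilbert_series (upset (10 + e) ?M) = decomposition_series (summands e ?T)"
    by (simp only: decomposition_series_summands)
  \<comment> \<open>The values in degrees 2 and 3 are 11 and 64 + 11e, and 64 + 11e < 11(6 +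
    e).\<close>
  show "fps_nth (hilbert_series (upset (10 + e) ?M)) 0 = 0"
    "fps_nth (hilbert_series (upset (10 + e) ?M)) 1 = 0"
    "fps_nth (hilbert_series (upset (10 + e) ?M)) 3 <
      int (Suc (5 + e)) * fps_nth (hilbert_series (upset (10 + e) ?M)) 2"
    unfolding h
    by (simp_all add: fps_X_power_mult_nth geometric_power_nth sum_atMost_10_plus del: sum.atMost_Suc)
qed

lemma hdepth_quad2:
  assumes J: "J \<subseteq> {1..10 + e}" "card J = 10" "2 \<in> J" and a: "a \<in> {2..10 + e}"
    and b: "b \<in> {3..10 + e}" "a \<noteq> b"
  shows "hdepth (10 + e) (Idl\<^bsub>poly_ring (10 + e)\<^esub> (mon ` (quad 1 ` J \<union> {quad 2 a, quad 2 b}))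
    :: 'k::field mpoly set) = 6 + e"
proof (rule hdepth_eqI[OF _ refl])
  \<comment> \<open>The multiples of x_1 cannot be treated separately now: for e = 0 they number 10
    and 55 in degrees 2 and 3, and 55 < 6 * 10. The two cones supply the missing dimensions. As 12 *
    6 = 72 fills degree 3, no entry has shift 3.\<close>
  let ?T = "[(12, 6, 2), (40, 6, 4), (20, 6, 5), (62, 6, 6), (83, 6, 7), (5, 7, 4), (3, 8, 4),
    (1, 9, 4), (84, 7, 8), (28, 8, 8), (7, 9, 8), (1, 10, 8)] :: (nat \<times> nat \<times> nat) list"
  let ?M = "quad 1 ` J \<union> {quad 2 a, quad 2 b}"
  have h: "hilbert_series (upset (10 + e) ?M) =
      fps_X * (geometric ^ (10 + e) - geometric ^ e) + fps_X ^ 2 * geometric ^ (9 + e) +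
      fps_X ^ 2 * geometric ^ (8 + e)"
    using hilbert_series_upset_quad2[OF J(1,3) a b] J(2) by simp
  show "?M \<subseteq> monomials {1..10 + e}"
    using quads_subset_monomials[OF J(1) a, of b] b by simp
  show "\<forall>(Z, s)\<in>set (summands e ?T). Z \<subseteq> {1..10 + e} \<and> 6 + e \<le> card Z"
    by (rule summands_subset) simp
  have "hilbert_series (upset (10 + e) ?M) =
      (fps_X * (geometric ^ 10 - 1) + fps_X ^ 2 * geometric ^ 9 + fps_X ^ 2 * geometric ^ 8)
      * geometric ^ e"
    unfolding h by (simp add: power_add algebra_simps)
  also have "fps_X * (geometric ^ 10 - 1) + fps_X ^ 2 * geometric ^ 9 + fps_X ^ 2 * geometric ^ 8 =
      (\<Sum>(c, k, s)\<leftarrow>?T. of_nat c * fps_X ^ s * geometric ^ k)"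
    using geometric_identity2[OF geometric_mult] by (simp add: algebra_simps)
  finally show "hilbert_series (upset (10 + e) ?M) = decomposition_series (summands e ?T)"
    by (simp only: decomposition_series_summands)
  \<comment> \<open>The values in degrees 2 and 3 are 12 and 72 + 12e = 12(6 + e).\<close>
  show "fps_nth (hilbert_series (upset (10 + e) ?M)) 0 = 0"
    "fps_nth (hilbert_series (upset (10 + e) ?M)) 1 = 0"
    "fps_nth (hilbert_series (upset (10 + e) ?M)) 3 <
      int (Suc (6 + e)) * fps_nth (hilbert_series (upset (10 + e) ?M)) 2"
    unfolding h
    by (simp_all add: fps_X_power_mult_nth geometric_power_nth sum_atMost_10_plus del: sum.atMost_Suc)
qed

section \<open>From sets of generators to ideals\<close>

lemma mon_in_Idl_mon_iff:
  assumes "M \<subseteq> monomials {1..n}"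
  shows "mon m \<in> (Idl\<^bsub>poly_ring n\<^esub> (mon ` M) :: 'k::field mpoly set) \<longleftrightarrow> m \<in> upset n M"
  by (simp add: Idl_mon_eq[OF assms])

lemma Idl_mon_psubset:
  assumes "M \<subseteq> N" "N \<subseteq> monomials {1..n}" "m \<in> N" "\<forall>g\<in>M. \<not> divides g m"
  shows "Idl\<^bsub>poly_ring n\<^esub> (mon ` M) \<subset> (Idl\<^bsub>poly_ring n\<^esub> (mon ` N) :: 'k::field mpoly set)"
proof
  have M: "M \<subseteq> monomials {1..n}" using assms by blast
  have "upset n M \<subseteq> upset n N" using assms(1) unfolding upset_def by blast
  then show "Idl\<^bsub>poly_ring n\<^esub> (mon ` M) \<subseteq> (Idl\<^bsub>poly_ring n\<^esub> (mon ` N) :: 'k mpoly set)"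
    by (auto simp: Idl_mon_eq[OF M] Idl_mon_eq[OF assms(2)] supported_on_def)
  have "m \<in> upset n N" "m \<notin> upset n M"
    using assms by (auto simp: mem_upset_iff divides_def)
  then have "mon m \<in> (Idl\<^bsub>poly_ring n\<^esub> (mon ` N) :: 'k mpoly set)"
    "mon m \<notin> (Idl\<^bsub>poly_ring n\<^esub> (mon ` M) :: 'k mpoly set)"
    by (simp_all add: mon_in_Idl_mon_iff[OF M] mon_in_Idl_mon_iff[OF assms(2)])
  then show "Idl\<^bsub>poly_ring n\<^esub> (mon ` M) \<noteq> (Idl\<^bsub>poly_ring n\<^esub> (mon ` N) :: 'k mpoly set)"
    by blast
qed

lemma lex_ideal_Idl_mon:
  assumes M: "M \<subseteq> monomials {1..n}"
    and "\<And>u v. u \<in> upset n M \<Longrightarrow> v \<in> monomials {1..n} \<Longrightarrow> mdeg v = mdeg u \<Longrightarrow> u < v \<Longrightarrow> v \<in> upset n M"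
  shows "lex_ideal n (Idl\<^bsub>poly_ring n\<^esub> (mon ` M) :: 'k::field mpoly set)"
  using assms by (auto simp: lex_ideal_def mon_in_Idl_mon_iff[OF M] monomial_ideal_on_def)

lemma squarefree_lex_ideal_Idl_mon:
  assumes M: "M \<subseteq> monomials {1..n}" and "M \<subseteq> squarefree_monomials"
    and "\<And>u v. u \<in> upset n M \<Longrightarrow> u \<in> squarefree_monomials \<Longrightarrow> v \<in> monomials {1..n} \<Longrightarrow>
      v \<in> squarefree_monomials \<Longrightarrow> mdeg v = mdeg u \<Longrightarrow> u < v \<Longrightarrow> v \<in> upset n M"
  shows "squarefree_lex_ideal n (Idl\<^bsub>poly_ring n\<^esub> (mon ` M) :: 'k::field mpoly set)"
proof -
  have "monomial_ideal_on n squarefree_monomials (Idl\<^bsub>poly_ring n\<^esub> (mon ` M) :: 'k mpoly set)"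
    using assms(1,2) unfolding monomial_ideal_on_def by blast
  then show ?thesis
    using assms(3) by (auto simp: squarefree_lex_ideal_def mon_in_Idl_mon_iff[OF M])
qed

lemma quad_squarefree: "i \<noteq> j \<Longrightarrow> quad i j \<in> squarefree_monomials"
  by (simp add: squarefree_monomials_def lookup_quad)

lemma X_mult_X: "X i * X j = mon (quad i j)"
  by (simp add: X_def quad_def mon_add)

lemma X_square: "X i ^ 2 = mon (quad i i)"
  by (simp add: power2_eq_square X_mult_X)

lemma lookup_squarefree_le:
  "m \<in> squarefree_monomials \<Longrightarrow> Poly_Mapping.lookup m i \<le> 1"
  by (simp add: squarefree_monomials_def)

section \<open>The four ideals\<close>

theorem mainTheorem8:
  fixes L1 L2 L1\<sigma> L2\<sigma> :: "'k::field mpoly set"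
  assumes L1: "L1 = Idl\<^bsub>poly_ring 10\<^esub> ({X 1 ^ 2} \<union> {X 1 * X j | j. j \<in> {2..10}} \<union> {X 2 ^ 2})"
    and L2: "L2 = Idl\<^bsub>poly_ring 10\<^esub>
               ({X 1 ^ 2} \<union> {X 1 * X j | j. j \<in> {2..10}} \<union> {X 2 ^ 2, X 2 * X 3})"
    and L1\<sigma>: "L1\<sigma> = Idl\<^bsub>poly_ring 11\<^esub> ({X 1 * X j | j. j \<in> {2..11}} \<union> {X 2 * X 3})"
    and L2\<sigma>: "L2\<sigma> = Idl\<^bsub>poly_ring 11\<^esub>
               ({X 1 * X j | j. j \<in> {2..11}} \<union> {X 2 * X 3, X 2 * X 4})"
  shows "lex_ideal 10 L1 \<and> lex_ideal 10 L2 \<and>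
         monomial_ideal_on 10 {m. mdeg m = 2} L1 \<and> monomial_ideal_on 10 {m. mdeg m = 2} L2 \<and>
         L1 \<subset> L2 \<and>
         hdepth 10 L1 = 5 \<and> hdepth 10 L2 = 6 \<and> hdepth 10 L1 < hdepth 10 L2 \<and>
         squarefree_lex_ideal 11 L1\<sigma> \<and> squarefree_lex_ideal 11 L2\<sigma> \<and>
         monomial_ideal_on 11 {m. mdeg m = 2} L1\<sigma> \<and> monomial_ideal_on 11 {m. mdeg m = 2} L2\<sigma> \<and>
         L1\<sigma> \<subset> L2\<sigma> \<and>
         hdepth 11 L1\<sigma> = 6 \<and> hdepth 11 L2\<sigma> = 7 \<and> hdepth 11 L1\<sigma> < hdepth 11 L2\<sigma>"
proof -
  define M1 where "M1 = quad 1 ` {1..10} \<union> {quad 2 2}"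
  define M2 where "M2 = quad 1 ` {1..10} \<union> {quad 2 2, quad 2 3}"
  define N1 where "N1 = quad 1 ` {2..11} \<union> {quad 2 3}"
  define N2 where "N2 = quad 1 ` {2..11} \<union> {quad 2 3, quad 2 4}"
  note defs = M1_def M2_def N1_def N2_def
  \<comment> \<open>Makes x_1^2 the member j = 1 of the family x_1 x_j, so that \<open>J\<close> is
    {1..10} for the lex ideals and {2..11} for the squarefree ones, with ten elements in both
    cases.\<close>
  have "{1..10::nat} = insert 1 {2..10}" by auto
  then have I: "L1 = Idl\<^bsub>poly_ring 10\<^esub> (mon ` M1)" "L2 = Idl\<^bsub>poly_ring 10\<^esub> (mon ` M2)"
    "L1\<sigma> = Idl\<^bsub>poly_ring 11\<^esub> (mon ` N1)" "L2\<sigma> = Idl\<^bsub>poly_ring 11\<^esub> (mon ` N2)"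
    unfolding L1 L2 L1\<sigma> L2\<sigma> defs X_mult_X X_square
    by (auto intro!: arg_cong[of _ _ "genideal (poly_ring _)"])
  have mons: "M1 \<subseteq> monomials {1..10}" "M2 \<subseteq> monomials {1..10}"
    "N1 \<subseteq> monomials {1..11}" "N2 \<subseteq> monomials {1..11}"
    by (auto simp: defs intro!: quad_in_monomials)
  have deg: "monomial_ideal_on n {m. mdeg m = 2} (Idl\<^bsub>poly_ring n\<^esub> (mon ` M) :: 'k mpoly set)"
    if "M \<subseteq> monomials {1..n}" "\<forall>m\<in>M. mdeg m = 2" for n M
    using that unfolding monomial_ideal_on_def by blast
  have sub: "L1 \<subset> L2" "L1\<sigma> \<subset> L2\<sigma>"
    unfolding I
    by (rule Idl_mon_psubset[OF _ mons(2), of _ "quad 2 3"] Idl_mon_psubset[OF _ mons(4), of _ "quad 2 4"];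
        auto simp: defs divides_quad_iff lookup_quad)+
  have hd: "hdepth 10 L1 = 5" "hdepth 10 L2 = 6" "hdepth 11 L1\<sigma> = 6" "hdepth 11 L2\<sigma> = 7"
    unfolding I defs
    using hdepth_quad[of "{1..10}" 0 2, where 'k = 'k] hdepth_quad2[of "{1..10}" 0 2 3, where 'k = 'k]
      hdepth_quad[of "{2..11}" 1 3, where 'k = 'k] hdepth_quad2[of "{2..11}" 1 3 4, where 'k = 'k]
    by simp_all
  have lex: "lex_ideal 10 L1" "lex_ideal 10 L2"
    unfolding I
  proof (rule_tac [!] lex_ideal_Idl_mon)
    show "v \<in> upset 10 M1"
      if "u \<in> upset 10 M1" "v \<in> monomials {1..10}" "mdeg v = mdeg u" "u < v" for u v
      using that unfolding M1_def
      by (intro lex_upset[where Q = UNIV and u = u]) (auto simp: divides_quad_iff)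
    show "v \<in> upset 10 M2"
      if "u \<in> upset 10 M2" "v \<in> monomials {1..10}" "mdeg v = mdeg u" "u < v" for u v
      using that unfolding M2_def
      by (intro lex_upset[where Q = UNIV and u = u]) (auto simp: divides_quad_iff)
  qed (rule mons)+
  have sqlex: "squarefree_lex_ideal 11 L1\<sigma>" "squarefree_lex_ideal 11 L2\<sigma>"
    unfolding I
  proof (rule_tac [!] squarefree_lex_ideal_Idl_mon)
    show "N1 \<subseteq> squarefree_monomials" "N2 \<subseteq> squarefree_monomials"
      by (auto simp: defs intro!: quad_squarefree)
    show "v \<in> upset 11 N1"
      if "u \<in> upset 11 N1" "u \<in> squarefree_monomials" "v \<in> monomials {1..11}"
        "v \<in> squarefree_monomials" "mdeg v = mdeg u" "u < v" for u v
      using that unfolding N1_def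
      \<comment> \<open>A generator x_2 x_3 dividing u forces exponent 1 of x_2 in u, and
        squarefreeness allows no more in v. So u and v agree there and x_3 decides.\<close>
      by (intro lex_upset[where Q = squarefree_monomials and u = u])
        (auto simp: divides_quad_iff dest!: lookup_squarefree_le[of _ 2])
    show "v \<in> upset 11 N2"
      if "u \<in> upset 11 N2" "u \<in> squarefree_monomials" "v \<in> monomials {1..11}"
        "v \<in> squarefree_monomials" "mdeg v = mdeg u" "u < v" for u v
      using that unfolding N2_def
      by (intro lex_upset[where Q = squarefree_monomials and u = u])
        (auto simp: divides_quad_iff dest!: lookup_squarefree_le[of _ 2])
  qed (rule mons)+
  have gens: "monomial_ideal_on 10 {m. mdeg m = 2} L1" "monomial_ideal_on 10 {m. mdeg m = 2} L2"
    "monomial_ideal_on 11 {m. mdeg m = 2} L1\<sigma>" "monomial_ideal_on 11 {m. mdeg m = 2} L2\<sigma>"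
    unfolding I by (rule deg[OF mons(1)] deg[OF mons(2)] deg[OF mons(3)] deg[OF mons(4)];
      auto simp: defs)+
  show ?thesis
    by (intro conjI lex gens sub sqlex) (simp_all add: hd)
qed

end
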